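(* Let $\mu$ be a compactly supported probability measure on $\mathbb{R}$ with Jacobi coefficients $(\{\omega_n\}_{n=1}^{\infty},\{\alpha_n\}_{n=1}^{\infty})$. Then there exist a self-adjoint $B(\ell_2(\mathbb{N}))$-valued semicircular random variable $s$ with first moment $D=(\alpha_k\delta_{kl})_{k,l=1}^{\infty}\in B(\ell_2(\mathbb{N}))$ and variance $$\eta:B(\ell_2(\mathbb{N}))\to B(\ell_2(\mathbb{N})),\qquad \eta\big((a_{kl})_{k,l=1}^{\infty}\big)=(\omega_k^{1/2}\delta_{(k+1)l})_{k,l=1}^{\infty}\,(a_{kl})_{k,l=1}^{\infty}\,(\omega_{k-1}^{1/2}\delta_{k(l+1)})_{k,l=1}^{\infty},$$ and a state $\rho:B(\ell_2(\mathbb{N}))\to\mathbb{C}$ such that the Cauchy transform $G_\mu:\mathbb{C}^+\to\mathbb{C}^-$ of $\mu$ is represented as $$G_\mu(\xi)=(\rho\circ G_s)(\xi\cdot 1)\qquad\text{for all }\xi\in\mathbb{C}^+ .$$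
   Context: Notation: $\mathbb{C}^{\pm}=\{\xi\in\mathbb{C}:\pm\mathrm{Im}\,\xi>0\}$; $\delta_{kl}$ is the Kronecker delta; $B(\ell_2(\mathbb{N}))$ is the algebra of bounded operators on $\ell_2(\mathbb{N})$, whose elements are written as infinite matrices with respect to the canonical orthonormal basis $\{e_n\}_{n\ge1}$. The Cauchy transform of a probability measure $\mu$ on $\mathbb{R}$ is $G_\mu(\xi)=\int_{\mathbb{R}}\frac{d\mu(t)}{\xi-t}$. Jacobi coefficients: for a compactly supported probability measure $\mu$ on $\mathbb{R}$, let $\{p_m\}_{m\ge0}$ be the monic orthogonal polynomials of $\mu$ (obtained by Gram-Schmidt orthogonalization of $1,t,t^2,\dots$ in $L^2(\mu)$). The Jacobi coefficients are the sequences $\{\alpha_m\}_{m=1}^{\infty}\subseteq\mathbb{R}$ and $\{\omega_m\}_{m=1}^{\infty}\subseteq(0,\infty)$ uniquely determined by $p_0(t)=1$, $p_1(t)=t-\alpha_1$, and $t\,p_m(t)=p_{m+1}(t)+\alpha_{m+1}p_m(t)+\omega_m p_{m-1}(t)$ for $m\ge1$. If $|\mathrm{Supp}(\mu)|=\infty$, both sequences are infinite. If $|\mathrm{Supp}(\mu)|=m_0<\infty$, the same notation stands for the finite sequences $\{\alpha_m\}_{m=1}^{\infty}=\{\alpha_m\}_{m=1}^{m_0}$ and $\{\omega_m\}_{m=1}^{\infty}=\{\omega_m\}_{m=1}^{m_0-1}$, with $p_{m_0}=0$ in $L^2(\mu)$. The symbol $\omega_0$ appearing in the formula for $\eta$ is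 always multiplied by $0$. Operator-valued semicircular random variables: let $A$ be a unital $C^*$-algebra, $\mathcal{B}\subseteq A$ a unital $C^*$-subalgebra, and $E:A\to\mathcal{B}$ a conditional expectation, i.e. a linear map with $E(b_1ab_2)=b_1E(a)b_2$ for $a\in A$, $b_1,b_2\in\mathcal{B}$, $E(1)=1$, and $E(a^*a)\ge0$. Put $\mathbb{H}^{\pm}(\mathcal{B})=\{b\in\mathcal{B}:\pm\mathrm{Im}(b)\geq\epsilon\cdot1\text{ for some }\epsilon>0\}$, where $\mathrm{Im}(b)=(b-b^* )/(2i)$. The operator-valued Cauchy transform of a self-adjoint $a\in A$ is $G_a:\mathbb{H}^+(\mathcal{B})\to\mathbb{H}^-(\mathcal{B})$, $G_a(b)=E((b-a)^{-1})$. For a self-adjoint $D\in\mathcal{B}$ and a completely positive map $\eta:\mathcal{B}\to\mathcal{B}$, a self-adjoint $s\in A$ is called a $\mathcal{B}$-valued semicircular random variable with first moment $D$ and variance $\eta$ if its operator-valued $R$-transform, determined by $bG_s(b)=1+R_s(G_s(b))G_s(b)$, is $R_s(b)=D+\eta(b)$. Then $D=E(s)$ and $\eta(b)=E(sbs)-E(s)bE(s)$, and $G_s$ is the unique solution $\mathbb{H}^+(\mathcal{B})\to\mathbb{H}^-(\mathcal{B})$ of $bG_s(b)=1+(D+\eta(G_s(b)))G_s(b)$ for $b\in\mathbb{H}^+(\mathcal{B})$, with $\lim_{b^{-1}\to0}bG_s(b)=1$. Here $\mathcal{B}=B(\ell_2(\mathbb{N}))$; the ambient $C^*$-algebra $A$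 and the conditional expectation $E$ are part of what is asserted to exist. *)

theory Defs
  imports
    "HOL-Probability.Probability"
    "HOL-Algebra.Module"
    "HOL-Computational_Algebra.Polynomial"
begin

section \<open>Jacobi coefficients of a measure on the real line\<close>

definition msupport :: "real measure \<Rightarrow> real set" where
  "msupport \<mu> = {x. \<forall>U. open U \<and> x \<in> U \<longrightarrow> emeasure \<mu> U > 0}"

definition compactly_supported :: "real measure \<Rightarrow> bool" where
  "compactly_supported \<mu> \<longleftrightarrow> compact (msupport \<mu>)"

definition L2_inner :: "real measure \<Rightarrow> real poly \<Rightarrow> real poly \<Rightarrow> real" where
  "L2_inner \<mu> p q = (\<integral>t. poly p t * poly q t \<partial>\<mu>)"

text \<open>
  Gram-Schmidt orthogonalization (without normalization) of the monomials. If the support has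
  \<open>m0\<close> points, then \<open>monic_OP \<mu> m0\<close> vanishes in $L^2(\mu)$; the values beyond \<open>m0\<close> are not used.
\<close>

fun monic_OP :: "real measure \<Rightarrow> nat \<Rightarrow> real poly" where
  "monic_OP \<mu> m = monom 1 m -
     (\<Sum>j<m. Polynomial.smult (L2_inner \<mu> (monom 1 m) (monic_OP \<mu> j) /
                     L2_inner \<mu> (monic_OP \<mu> j) (monic_OP \<mu> j)) (monic_OP \<mu> j))"

declare monic_OP.simps [simp del]

text \<open>
  \<open>\<alpha> m\<close> is meaningful for \<open>m \<ge> 1\<close> and \<open>\<omega> m\<close> for \<open>m \<ge> 1\<close>. If the support has \<open>m0 < \<infinity>\<close> points,
  the coefficients are finite sequences \<open>\<alpha> 1, \<dots>, \<alpha> m0\<close> and \<open>\<omega> 1, \<dots>, \<omega> (m0 - 1)\<close>, which are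
  extended by zero, so that they define infinite matrices.
\<close>

definition jacobi_coefficients :: "real measure \<Rightarrow> (nat \<Rightarrow> real) \<Rightarrow> (nat \<Rightarrow> real) \<Rightarrow> bool" where
  "jacobi_coefficients \<mu> \<omega> \<alpha> \<longleftrightarrow>
     monic_OP \<mu> 1 = [:- \<alpha> 1, 1:] \<and>
     (\<forall>m\<ge>1. (finite (msupport \<mu>) \<longrightarrow> m < card (msupport \<mu>)) \<longrightarrow>
        \<omega> m > 0 \<and>
        [:0, 1:] * monic_OP \<mu> m =
          monic_OP \<mu> (m + 1) + Polynomial.smult (\<alpha> (m + 1)) (monic_OP \<mu> m) + Polynomial.smult (\<omega> m) (monic_OP \<mu> (m - 1))) \<and>
     (finite (msupport \<mu>) \<longrightarrow>
        (\<forall>m > card (msupport \<mu>). \<alpha> m = 0) \<and> (\<forall>m \<ge> card (msupport \<mu>). \<omega> m = 0))"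

definition cauchy_transform :: "real measure \<Rightarrow> complex \<Rightarrow> complex" where
  "cauchy_transform \<mu> \<xi> = (\<integral>t. 1 / (\<xi> - complex_of_real t) \<partial>\<mu>)"


section \<open>Unital C*-algebras\<close>

definition complex_ring :: "complex ring" where
  "complex_ring = \<lparr>carrier = UNIV, mult = (*), one = 1, zero = 0, add = (+)\<rparr>"

record 'a cstar = "(complex, 'a) module" +
  involution :: "'a \<Rightarrow> 'a"
  cnorm :: "'a \<Rightarrow> real"

locale cstar_algebra = ring A + module complex_ring A for A :: "('a, 'm) cstar_scheme" (structure) +
  assumes smult_mult_left:
      "\<lbrakk>x \<in> carrier A; y \<in> carrier A\<rbrakk> \<Longrightarrow> (c \<odot> x) \<otimes> y = c \<odot> (x \<otimes> y)"
    and smult_mult_right: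
      "\<lbrakk>x \<in> carrier A; y \<in> carrier A\<rbrakk> \<Longrightarrow> x \<otimes> (c \<odot> y) = c \<odot> (x \<otimes> y)"
    and involution_closed: "x \<in> carrier A \<Longrightarrow> involution A x \<in> carrier A"
    and involution_involution: "x \<in> carrier A \<Longrightarrow> involution A (involution A x) = x"
    and involution_add:
      "\<lbrakk>x \<in> carrier A; y \<in> carrier A\<rbrakk> \<Longrightarrow> involution A (x \<oplus> y) = involution A x \<oplus> involution A y"
    and involution_smult: "x \<in> carrier A \<Longrightarrow> involution A (c \<odot> x) = cnj c \<odot> involution A x"
    and involution_mult:
      "\<lbrakk>x \<in> carrier A; y \<in> carrier A\<rbrakk> \<Longrightarrow> involution A (x \<otimes> y) = involution A y \<otimes> involution A x"
    and cnorm_nonneg: "x \<in> carrier A \<Longrightarrow> 0 \<le> cnorm A x"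
    and cnorm_eq_zero: "x \<in> carrier A \<Longrightarrow> cnorm A x = 0 \<longleftrightarrow> x = \<zero>"
    and cnorm_triangle:
      "\<lbrakk>x \<in> carrier A; y \<in> carrier A\<rbrakk> \<Longrightarrow> cnorm A (x \<oplus> y) \<le> cnorm A x + cnorm A y"
    and cnorm_smult: "x \<in> carrier A \<Longrightarrow> cnorm A (c \<odot> x) = cmod c * cnorm A x"
    and cnorm_mult:
      "\<lbrakk>x \<in> carrier A; y \<in> carrier A\<rbrakk> \<Longrightarrow> cnorm A (x \<otimes> y) \<le> cnorm A x * cnorm A y"
    and cnorm_involution_mult: "x \<in> carrier A \<Longrightarrow> cnorm A (involution A x \<otimes> x) = (cnorm A x)\<^sup>2"
    and complete:
      "\<lbrakk>range X \<subseteq> carrier A; \<forall>\<epsilon>>0. \<exists>N. \<forall>m\<ge>N. \<forall>n\<ge>N. cnorm A (X m \<ominus> X n) < \<epsilon>\<rbrakk> \<Longrightarrow>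
         \<exists>L\<in>carrier A. (\<lambda>n::nat. cnorm A (X n \<ominus> L)) \<longlonglongrightarrow> 0"

definition cstar_positive :: "('a, 'm) cstar_scheme \<Rightarrow> 'a \<Rightarrow> bool" where
  "cstar_positive A a \<longleftrightarrow> (\<exists>x\<in>carrier A. a = involution A x \<otimes>\<^bsub>A\<^esub> x)"

definition cstar_linear ::
  "('a, 'm) cstar_scheme \<Rightarrow> ('b, 'n) cstar_scheme \<Rightarrow> ('a \<Rightarrow> 'b) \<Rightarrow> bool" where
  "cstar_linear A B f \<longleftrightarrow>
     f \<in> carrier A \<rightarrow> carrier B \<and>
     (\<forall>x\<in>carrier A. \<forall>y\<in>carrier A. f (x \<oplus>\<^bsub>A\<^esub> y) = f x \<oplus>\<^bsub>B\<^esub> f y) \<and>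
     (\<forall>c. \<forall>x\<in>carrier A. f (c \<odot>\<^bsub>A\<^esub> x) = c \<odot>\<^bsub>B\<^esub> f x)"

text \<open>
  Positive elements of the C*-algebra of \<open>n\<close>-by-\<open>n\<close> matrices over \<open>A\<close> are those of the form
  \<open>X* X\<close>, whose entry at \<open>(i, j)\<close> is the sum of the elements \<open>(X k i)* (X k j)\<close> over \<open>k < n\<close>.
\<close>

definition cstar_matrix_gram ::
  "('a, 'm) cstar_scheme \<Rightarrow> nat \<Rightarrow> (nat \<Rightarrow> nat \<Rightarrow> 'a) \<Rightarrow> nat \<Rightarrow> nat \<Rightarrow> 'a" where
  "cstar_matrix_gram A n X i j = (\<Oplus>\<^bsub>A\<^esub>k\<in>{..<n}. involution A (X k i) \<otimes>\<^bsub>A\<^esub> X k j)"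

definition completely_positive ::
  "('a, 'm) cstar_scheme \<Rightarrow> ('b, 'n) cstar_scheme \<Rightarrow> ('a \<Rightarrow> 'b) \<Rightarrow> bool" where
  "completely_positive A B \<phi> \<longleftrightarrow>
     cstar_linear A B \<phi> \<and>
     (\<forall>n X. (\<forall>i<n. \<forall>j<n. X i j \<in> carrier A) \<longrightarrow>
        (\<exists>Y. (\<forall>i<n. \<forall>j<n. Y i j \<in> carrier B) \<and>
             (\<forall>i<n. \<forall>j<n. \<phi> (cstar_matrix_gram A n X i j) = cstar_matrix_gram B n Y i j)))"

definition cstar_state :: "('a, 'm) cstar_scheme \<Rightarrow> ('a \<Rightarrow> complex) \<Rightarrow> bool" where
  "cstar_state A \<rho> \<longleftrightarrow>
     (\<forall>x\<in>carrier A. \<forall>y\<in>carrier A. \<rho> (x \<oplus>\<^bsub>A\<^esub> y) = \<rho> x + \<rho> y) \<and>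
     (\<forall>c. \<forall>x\<in>carrier A. \<rho> (c \<odot>\<^bsub>A\<^esub> x) = c * \<rho> x) \<and>
     (\<forall>x\<in>carrier A. \<rho> (involution A x \<otimes>\<^bsub>A\<^esub> x) \<in> \<real>\<^sub>\<ge>\<^sub>0) \<and>
     \<rho> \<one>\<^bsub>A\<^esub> = 1"


section \<open>Operator-valued semicircular random variables\<close>

text \<open>
  The inclusion of a unital C*-subalgebra \<open>B\<close> into \<open>A\<close> is an isometric unital
  *-homomorphism \<open>\<iota>\<close> rather than a literal inclusion of carriers.
\<close>

definition cstar_embedding ::
  "('b, 'n) cstar_scheme \<Rightarrow> ('a, 'm) cstar_scheme \<Rightarrow> ('b \<Rightarrow> 'a) \<Rightarrow> bool" where
  "cstar_embedding B A \<iota> \<longleftrightarrow>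
     \<iota> \<in> ring_hom B A \<and> cstar_linear B A \<iota> \<and>
     (\<forall>b\<in>carrier B. \<iota> (involution B b) = involution A (\<iota> b)) \<and>
     (\<forall>b\<in>carrier B. cnorm A (\<iota> b) = cnorm B b)"

definition conditional_expectation ::
  "('a, 'm) cstar_scheme \<Rightarrow> ('b, 'n) cstar_scheme \<Rightarrow> ('b \<Rightarrow> 'a) \<Rightarrow> ('a \<Rightarrow> 'b) \<Rightarrow> bool" where
  "conditional_expectation A B \<iota> E \<longleftrightarrow>
     cstar_linear A B E \<and>
     (\<forall>a\<in>carrier A. \<forall>b1\<in>carrier B. \<forall>b2\<in>carrier B.
        E (\<iota> b1 \<otimes>\<^bsub>A\<^esub> a \<otimes>\<^bsub>A\<^esub> \<iota> b2) = b1 \<otimes>\<^bsub>B\<^esub> E a \<otimes>\<^bsub>B\<^esub> b2) \<and>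
     E \<one>\<^bsub>A\<^esub> = \<one>\<^bsub>B\<^esub> \<and>
     (\<forall>a\<in>carrier A. cstar_positive B (E (involution A a \<otimes>\<^bsub>A\<^esub> a)))"

definition opvalued_space ::
  "('a, 'm) cstar_scheme \<Rightarrow> ('b, 'n) cstar_scheme \<Rightarrow> ('b \<Rightarrow> 'a) \<Rightarrow> ('a \<Rightarrow> 'b) \<Rightarrow> bool" where
  "opvalued_space A B \<iota> E \<longleftrightarrow>
     cstar_algebra A \<and> cstar_algebra B \<and> cstar_embedding B A \<iota> \<and> conditional_expectation A B \<iota> E"

definition cstar_Im :: "('b, 'n) cstar_scheme \<Rightarrow> 'b \<Rightarrow> 'b" where
  "cstar_Im B b = (1 / (2 * \<i>)) \<odot>\<^bsub>B\<^esub> (b \<ominus>\<^bsub>B\<^esub> involution B b)"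

definition upper_half_plane :: "('b, 'n) cstar_scheme \<Rightarrow> 'b set" where
  "upper_half_plane B =
     {b \<in> carrier B. \<exists>\<epsilon>>0. cstar_positive B (cstar_Im B b \<ominus>\<^bsub>B\<^esub> complex_of_real \<epsilon> \<odot>\<^bsub>B\<^esub> \<one>\<^bsub>B\<^esub>)}"

definition opvalued_cauchy ::
  "('a, 'm) cstar_scheme \<Rightarrow> ('b \<Rightarrow> 'a) \<Rightarrow> ('a \<Rightarrow> 'b) \<Rightarrow> 'a \<Rightarrow> 'b \<Rightarrow> 'b" where
  "opvalued_cauchy A \<iota> E a b = E (inv\<^bsub>A\<^esub> (\<iota> b \<ominus>\<^bsub>A\<^esub> a))"

text \<open>
  The R-transform enters only through the relation $b\, G(b) = 1 + R(G(b))\, G(b)$ on the upper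
  half plane, so it is pinned down on the range of \<open>G\<close> there. The resolvent exists because the
  imaginary part of \<open>b\<close> is bounded below and \<open>a\<close> is self-adjoint.
\<close>

definition is_R_transform ::
  "('a, 'm) cstar_scheme \<Rightarrow> ('b, 'n) cstar_scheme \<Rightarrow> ('b \<Rightarrow> 'a) \<Rightarrow> ('a \<Rightarrow> 'b) \<Rightarrow> 'a \<Rightarrow> ('b \<Rightarrow> 'b) \<Rightarrow> bool"
where
  "is_R_transform A B \<iota> E a R \<longleftrightarrow>
     (\<forall>b\<in>upper_half_plane B. let g = opvalued_cauchy A \<iota> E a b in
        b \<otimes>\<^bsub>B\<^esub> g = \<one>\<^bsub>B\<^esub> \<oplus>\<^bsub>B\<^esub> R g \<otimes>\<^bsub>B\<^esub> g)"

definition semicircular ::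
  "('a, 'm) cstar_scheme \<Rightarrow> ('b, 'n) cstar_scheme \<Rightarrow> ('b \<Rightarrow> 'a) \<Rightarrow> ('a \<Rightarrow> 'b) \<Rightarrow>
     'a \<Rightarrow> 'b \<Rightarrow> ('b \<Rightarrow> 'b) \<Rightarrow> bool" where
  "semicircular A B \<iota> E s D \<eta> \<longleftrightarrow>
     s \<in> carrier A \<and> involution A s = s \<and>
     D \<in> carrier B \<and> involution B D = D \<and>
     completely_positive B B \<eta> \<and>
     is_R_transform A B \<iota> E s (\<lambda>b. D \<oplus>\<^bsub>B\<^esub> \<eta> b)"


section \<open>The Hilbert space of square-summable sequences and its bounded operators\<close>

text \<open>Sequences are indexed from 0: coordinate \<open>n\<close> here is the coordinate along $e_{n+1}$.\<close>

typedef ell2 = "{x :: nat \<Rightarrow> complex. summable (\<lambda>n. (cmod (x n))\<^sup>2)}"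
  morphisms coord Abs_ell2
  by (rule exI[of _ "\<lambda>_. 0"]) simp

setup_lifting type_definition_ell2

lemma square_summable_add:
  fixes x y :: "nat \<Rightarrow> complex"
  assumes "summable (\<lambda>n. (cmod (x n))\<^sup>2)" "summable (\<lambda>n. (cmod (y n))\<^sup>2)"
  shows "summable (\<lambda>n. (cmod (x n + y n))\<^sup>2)"
proof (rule summable_comparison_test')
  show "summable (\<lambda>n. 2 * (cmod (x n))\<^sup>2 + 2 * (cmod (y n))\<^sup>2)"
    by (intro summable_add summable_mult assms)
  show "norm ((cmod (x n + y n))\<^sup>2) \<le> 2 * (cmod (x n))\<^sup>2 + 2 * (cmod (y n))\<^sup>2" if "n \<ge> 0" for n
  proof -
    have "(cmod (x n + y n))\<^sup>2 \<le> (cmod (x n) + cmod (y n))\<^sup>2"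
      by (intro power_mono norm_triangle_ineq) auto
    also have "\<dots> \<le> 2 * (cmod (x n))\<^sup>2 + 2 * (cmod (y n))\<^sup>2"
      using zero_le_power2[of "cmod (x n) - cmod (y n)"] by (simp add: power2_eq_square algebra_simps)
    finally show ?thesis by simp
  qed
qed

lemma square_summable_mult:
  fixes x :: "nat \<Rightarrow> complex"
  assumes "summable (\<lambda>n. (cmod (x n))\<^sup>2)"
  shows "summable (\<lambda>n. (cmod (c * x n))\<^sup>2)"
  using summable_mult[OF assms, of "(cmod c)\<^sup>2"] by (simp add: norm_mult power_mult_distrib)

lemma square_summable_inner:
  fixes x y :: "nat \<Rightarrow> complex"
  assumes "summable (\<lambda>n. (cmod (x n))\<^sup>2)" "summable (\<lambda>n. (cmod (y n))\<^sup>2)"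
  shows "summable (\<lambda>n. x n \<bullet> y n)"
proof (rule summable_comparison_test')
  show "summable (\<lambda>n. (cmod (x n))\<^sup>2 + (cmod (y n))\<^sup>2)"
    by (intro summable_add assms)
  show "norm (x n \<bullet> y n) \<le> (cmod (x n))\<^sup>2 + (cmod (y n))\<^sup>2" if "n \<ge> 0" for n
  proof -
    have "\<bar>x n \<bullet> y n\<bar> \<le> cmod (x n) * cmod (y n)"
      by (rule Cauchy_Schwarz_ineq2)
    moreover have "2 * (cmod (x n) * cmod (y n)) \<le> (cmod (x n))\<^sup>2 + (cmod (y n))\<^sup>2"
      using sum_squares_bound[of "cmod (x n)" "cmod (y n)"] by (simp add: mult.assoc)
    moreover have "0 \<le> cmod (x n) * cmod (y n)" by simp
    ultimately have "\<bar>x n \<bullet> y n\<bar> \<le> (cmod (x n))\<^sup>2 + (cmod (y n))\<^sup>2" by linarith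
    then show ?thesis by simp
  qed
qed

lemma coord_square_summable: "summable (\<lambda>n. (cmod (coord x n))\<^sup>2)"
  using coord[of x] by simp

instantiation ell2 :: real_inner
begin

lift_definition zero_ell2 :: ell2 is "\<lambda>_. 0" by simp

lift_definition plus_ell2 :: "ell2 \<Rightarrow> ell2 \<Rightarrow> ell2" is "\<lambda>x y n. x n + y n"
  by (rule square_summable_add)

lift_definition uminus_ell2 :: "ell2 \<Rightarrow> ell2" is "\<lambda>x n. - x n" by simp

lift_definition minus_ell2 :: "ell2 \<Rightarrow> ell2 \<Rightarrow> ell2" is "\<lambda>x y n. x n - y n"
  using square_summable_add[of _ "\<lambda>n. - _ n"] by simp

lift_definition scaleR_ell2 :: "real \<Rightarrow> ell2 \<Rightarrow> ell2" is "\<lambda>r x n. complex_of_real r * x n"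
  by (rule square_summable_mult)

lift_definition inner_ell2 :: "ell2 \<Rightarrow> ell2 \<Rightarrow> real" is "\<lambda>x y. \<Sum>n. x n \<bullet> y n" .

definition norm_ell2 :: "ell2 \<Rightarrow> real" where "norm_ell2 x = sqrt (x \<bullet> x)"

definition sgn_ell2 :: "ell2 \<Rightarrow> ell2" where "sgn_ell2 x = scaleR (inverse (norm x)) x"

definition dist_ell2 :: "ell2 \<Rightarrow> ell2 \<Rightarrow> real" where "dist_ell2 x y = norm (x - y)"

definition uniformity_ell2 :: "(ell2 \<times> ell2) filter" where
  "uniformity_ell2 = (INF e\<in>{0<..}. principal {(x, y). dist x y < e})"

definition open_ell2 :: "ell2 set \<Rightarrow> bool" where
  "open_ell2 U \<longleftrightarrow> (\<forall>x\<in>U. \<forall>\<^sub>F (x', y) in uniformity. x' = x \<longrightarrow> y \<in> U)"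

instance
proof
  fix x y z :: ell2 and r s :: real
  show "x + y + z = x + (y + z)" by transfer (simp add: algebra_simps)
  show "x + y = y + x" by transfer (simp add: algebra_simps)
  show "0 + x = x" by transfer simp
  show "- x + x = 0" by transfer simp
  show "x - y = x + - y" by transfer simp
  show "r *\<^sub>R (x + y) = r *\<^sub>R x + r *\<^sub>R y" by transfer (simp add: algebra_simps)
  show "(r + s) *\<^sub>R x = r *\<^sub>R x + s *\<^sub>R x" by transfer (simp add: algebra_simps)
  show "r *\<^sub>R s *\<^sub>R x = (r * s) *\<^sub>R x" by transfer (simp add: algebra_simps)
  show "1 *\<^sub>R x = x" by transfer simp
  show "sgn x = inverse (norm x) *\<^sub>R x" by (rule sgn_ell2_def)
  show "dist x y = norm (x - y)" by (rule dist_ell2_def)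
  show "uniformity = (INF e\<in>{0<..}. principal {(x::ell2, y). dist x y < e})"
    by (rule uniformity_ell2_def)
  show "open U \<longleftrightarrow> (\<forall>x\<in>U. \<forall>\<^sub>F (x', y) in uniformity. x' = x \<longrightarrow> y \<in> U)" for U :: "ell2 set"
    by (rule open_ell2_def)
  show "x \<bullet> y = y \<bullet> x" by transfer (simp add: inner_commute)
  show "(x + y) \<bullet> z = x \<bullet> z + y \<bullet> z"
    by transfer (simp add: inner_add_left suminf_add square_summable_inner)
  show "(r *\<^sub>R x) \<bullet> y = r * (x \<bullet> y)"
    by transfer (simp add: suminf_mult square_summable_inner flip: scaleR_conv_of_real)
  show "0 \<le> x \<bullet> x"
    by transfer (auto intro!: suminf_nonneg square_summable_inner)
  show "x \<bullet> x = 0 \<longleftrightarrow> x = 0"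
    by transfer (auto simp: suminf_eq_zero_iff square_summable_inner)
  show "norm x = sqrt (x \<bullet> x)" by (rule norm_ell2_def)
qed

end

lift_definition scaleC :: "complex \<Rightarrow> ell2 \<Rightarrow> ell2" is "\<lambda>c x n. c * x n"
  by (rule square_summable_mult)

definition cinner :: "ell2 \<Rightarrow> ell2 \<Rightarrow> complex" where
  "cinner x y = (\<Sum>n. cnj (coord x n) * coord y n)"

lift_definition basis_vec :: "nat \<Rightarrow> ell2" is "\<lambda>k n. of_bool (n = k)"
proof -
  fix k :: nat
  show "summable (\<lambda>n. (cmod (of_bool (n = k)))\<^sup>2)"
    by (rule summable_finite[of "{k}"]) auto
qed

lemma norm_scaleC: "norm (scaleC c x) = cmod c * norm x"
proof -
  have "scaleC c x \<bullet> scaleC c x = (cmod c)\<^sup>2 * (x \<bullet> x)"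
    by transfer (simp add: suminf_mult norm_mult power_mult_distrib flip: power2_norm_eq_inner)
  then show ?thesis by (simp add: norm_eq_sqrt_inner real_sqrt_mult)
qed

lemma bounded_linear_scaleC: "bounded_linear (scaleC c)"
proof (rule bounded_linear_intro[where K = "cmod c"])
  show "scaleC c (x + y) = scaleC c x + scaleC c y" for x y by transfer (simp add: algebra_simps)
  show "scaleC c (r *\<^sub>R x) = r *\<^sub>R scaleC c x" for r x by transfer (simp add: algebra_simps)
  show "norm (scaleC c x) \<le> norm x * cmod c" for x by (simp add: norm_scaleC)
qed

lift_definition scaleC_op :: "complex \<Rightarrow> ell2 \<Rightarrow>\<^sub>L ell2" is scaleC
  by (rule bounded_linear_scaleC)

definition adjoint_op :: "(ell2 \<Rightarrow>\<^sub>L ell2) \<Rightarrow> (ell2 \<Rightarrow>\<^sub>L ell2)" where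
  "adjoint_op T = (THE S. \<forall>x y. cinner (blinfun_apply S x) y = cinner x (blinfun_apply T y))"

text \<open>
  The elements of \<open>ell2 \<Rightarrow>\<^sub>L ell2\<close> are bounded real-linear; the carrier consists of the
  complex-linear ones.
\<close>

definition B_ell2 :: "(ell2 \<Rightarrow>\<^sub>L ell2) cstar" where
  "B_ell2 = \<lparr>
     carrier = {T. \<forall>c x. blinfun_apply T (scaleC c x) = scaleC c (blinfun_apply T x)},
     mult = (o\<^sub>L), one = id_blinfun, zero = 0, add = (+),
     smult = (\<lambda>c T. scaleC_op c o\<^sub>L T),
     involution = adjoint_op,
     cnorm = norm\<rparr>"

text \<open>
  Entry \<open>(k, l)\<close> here is the entry at position \<open>(k + 1, l + 1)\<close> in the usual numbering from 1.
\<close>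

definition op_matrix :: "(ell2 \<Rightarrow>\<^sub>L ell2) \<Rightarrow> nat \<Rightarrow> nat \<Rightarrow> complex" where
  "op_matrix T k l = coord (blinfun_apply T (basis_vec l)) k"

end

theory Submission
  imports Defs
begin

text \<open>
  Identify \<open>ell2\<close> with \<open>ell2 \<otimes> ell2\<close> and let \<open>\<iota>(b) = b \<otimes> 1\<close>, with \<open>E\<close> the compression to
  $\ell_2 \otimes e_0$. With $\ell$ the unilateral shift, the block Jacobi operator
  $s = D \otimes 1 + V \otimes \ell^* + V^* \otimes \ell$ is unchanged when its first block row and
  column are removed. A Schur complement of \<open>\<iota>(b) - s\<close> therefore gives
  $b G = 1 + (D + V G V^*) G$ for $G = E((\iota(b) - s)^{-1})$, so \<open>s\<close> is semicircular with variance
  $a \mapsto V a V^*$. The vectors $e_k \otimes e_k$ span a subspace invariant under \<open>s\<close>, on which \<open>s\<close>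
  acts as the scalar Jacobi matrix of \<open>\<mu>\<close>; hence the vector state of $e_0 \otimes e_0$ reproduces the
  moments of \<open>\<mu>\<close>, and polynomial approximation of $1/(\xi - t)$ on the support carries this over
  to the Cauchy transform.
\<close>

text \<open>The statement leaves the ambient algebra open but types its elements as operators on
  \<open>ell2\<close>. The tensor square is therefore folded back into \<open>ell2\<close> by two
  isometries with complementary ranges, and operator identities are checked on even and odd parts.
  Compact support enters first through boundedness of the coefficients, without which D and V would
  not be operators: \<alpha> is a Rayleigh quotient of multiplication by t, and \<omega> is a ratio
  of squared norms of consecutive polynomials. The passage from moments to the Cauchy transform
  rests on the identity that the squared norm of p(s) d is the integral of p^2, where d is the
  tensor square of e_0. Approximation errors are thus measured on an interval around the support,
  and nothing about the spectrum of s has to be known. For a support of m0 points, the extension by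
  zero gives \<omega> m0 = 0. This forces p_{m0}(s) d = 0, the counterpart of p_{m0} = 0 in L^2, and
  makes the moments agree in all degrees.\<close>

section \<open>The Hilbert space of square-summable sequences\<close>

lemma coord_simps [simp]:
  "coord 0 n = 0" "coord (x + y) n = coord x n + coord y n" "coord (- x) n = - coord x n"
  "coord (x - y) n = coord x n - coord y n" "coord (r *\<^sub>R x) n = complex_of_real r * coord x n"
  "coord (scaleC c x) n = c * coord x n" "coord (basis_vec k) n = of_bool (n = k)"
  by (transfer; simp)+

lemma ell2_eqI: "(\<And>n. coord x n = coord y n) \<Longrightarrow> x = y"
  by (metis coord_inject ext)

lemma inner_ell2_sums: "(\<lambda>n. coord x n \<bullet> coord y n) sums (x \<bullet> y)"
  unfolding inner_ell2.rep_eq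
  by (intro summable_sums square_summable_inner coord_square_summable)

lemma norm_ell2_sums: "(\<lambda>n. (cmod (coord x n))\<^sup>2) sums (norm x)\<^sup>2"
  using inner_ell2_sums[of x x] by (simp add: power2_norm_eq_inner)

lemma sum_coord_le: "finite I \<Longrightarrow> (\<Sum>n\<in>I. (cmod (coord x n))\<^sup>2) \<le> (norm x)\<^sup>2"
  using norm_ell2_sums[of x] by (intro sum_le_suminf[THEN order_trans]) (auto simp: sums_iff)

lemma coord_le: "cmod (coord x n) \<le> norm x"
  by (rule power2_le_imp_le) (use sum_coord_le[of "{n}" x] in auto)

lemma bounded_linear_coord: "bounded_linear (\<lambda>x. coord x n)"
  by (rule bounded_linear_intro[where K = 1]) (auto simp: coord_le scaleR_conv_of_real)

text \<open>Operators are built below from prescribed coordinates. One uniform bound on partial sums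
  yields both membership in \<open>ell2\<close> and the norm estimate that boundedness
  requires.\<close>

lemma square_summable_ell2I:
  fixes f :: "nat \<Rightarrow> complex"
  assumes "\<And>N. (\<Sum>n<N. (cmod (f n))\<^sup>2) \<le> C"
  obtains x where "coord x = f" "(norm x)\<^sup>2 \<le> C"
proof -
  have s: "summable (\<lambda>n. (cmod (f n))\<^sup>2)"
    by (rule summableI_nonneg_bounded[of _ C]) (use assms in auto)
  define x where "x = Abs_ell2 f"
  have x: "coord x = f" unfolding x_def using s by (simp add: Abs_ell2_inverse)
  have "(norm x)\<^sup>2 \<le> C"
    using norm_ell2_sums[of x] suminf_le_const[OF s, of C] assms unfolding x by (simp add: sums_iff)
  with x show thesis using that by blast
qed

text \<open>The limit is taken coordinatewise; every finite partial sum of squares passes to the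
  limit with a bound independent of its length. Completeness serves the contraction argument that
  inverts operators and the completeness of \<open>B_ell2\<close>.\<close>

instance ell2 :: banach
proof
  fix X :: "nat \<Rightarrow> ell2" assume "Cauchy X"
  then have cc: "Cauchy (\<lambda>i. coord (X i) n)" for n
    using bounded_linear_coord by (rule bounded_linear.Cauchy[rotated])
  define f where "f n = lim (\<lambda>i. coord (X i) n)" for n
  have f: "(\<lambda>i. coord (X i) n) \<longlonglongrightarrow> f n" for n
    using Cauchy_convergent[OF cc[of n]] unfolding f_def by (simp only: convergent_LIMSEQ_iff)
  have close: "\<exists>N. \<forall>i\<ge>N. \<forall>M. (\<Sum>n<M. (cmod (coord (X i) n - f n))\<^sup>2) \<le> e\<^sup>2" if "e > 0" for e
  proof -
    from \<open>Cauchy X\<close> that obtain N where N: "\<And>i j. i \<ge> N \<Longrightarrow> j \<ge> N \<Longrightarrow> dist (X i) (X j) < e"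
      unfolding Cauchy_def by meson
    have "(\<Sum>n<M. (cmod (coord (X i) n - f n))\<^sup>2) \<le> e\<^sup>2" if i: "i \<ge> N" for i M
    proof (rule tendsto_upperbound)
      show "(\<lambda>j. \<Sum>n<M. (cmod (coord (X i) n - coord (X j) n))\<^sup>2)
          \<longlonglongrightarrow> (\<Sum>n<M. (cmod (coord (X i) n - f n))\<^sup>2)"
        by (intro tendsto_intros f)
      have "(\<Sum>n<M. (cmod (coord (X i) n - coord (X j) n))\<^sup>2) \<le> e\<^sup>2" if "j \<ge> N" for j
      proof -
        have "(\<Sum>n<M. (cmod (coord (X i - X j) n))\<^sup>2) \<le> (norm (X i - X j))\<^sup>2"
          by (rule sum_coord_le) simp
        also have "\<dots> \<le> e\<^sup>2"
          using N[OF i that] by (intro power_mono) (auto simp: dist_norm)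
        finally show ?thesis by simp
      qed
      then show "\<forall>\<^sub>F j in sequentially. (\<Sum>n<M. (cmod (coord (X i) n - coord (X j) n))\<^sup>2) \<le> e\<^sup>2"
        using eventually_sequentially by blast
    qed simp
    then show ?thesis by blast
  qed
  \<comment> \<open>The limit \<open>f\<close> is square summable because it differs from some
    \<open>X N\<close> by a sequence with bounded partial sums.\<close>
  from close[of 1] obtain N where N: "\<And>M. (\<Sum>n<M. (cmod (coord (X N) n - f n))\<^sup>2) \<le> 1\<^sup>2"
    by auto
  then obtain z where z: "coord z = (\<lambda>n. coord (X N) n - f n)"
    using square_summable_ell2I by metis
  define L where "L = X N - z"
  have L: "coord L n = f n" for n by (simp add: L_def z)
  have "X \<longlonglongrightarrow> L"
  proof (rule LIMSEQ_I)
    fix r :: real assume "r > 0"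
    then obtain N where N: "\<And>i M. i \<ge> N \<Longrightarrow> (\<Sum>n<M. (cmod (coord (X i) n - f n))\<^sup>2) \<le> (r/2)\<^sup>2"
      using close[of "r/2"] by auto
    have "norm (X i - L) < r" if "i \<ge> N" for i
    proof -
      have "(norm (X i - L))\<^sup>2 \<le> (r/2)\<^sup>2"
        using norm_ell2_sums[of "X i - L"] N[OF that]
          suminf_le_const[of "\<lambda>n. (cmod (coord (X i) n - f n))\<^sup>2" "(r/2)\<^sup>2"]
        by (simp add: L sums_iff)
      then have "norm (X i - L) \<le> r/2" by (rule power2_le_imp_le) (use \<open>r > 0\<close> in simp)
      then show ?thesis using \<open>r > 0\<close> by simp
    qed
    then show "\<exists>no. \<forall>n\<ge>no. norm (X n - L) < r" by blast
  qed
  then show "convergent X" by (auto simp: convergent_def)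
qed

section \<open>Complex scalars and the complex inner product\<close>

lemma scaleC_simps [simp]:
  "scaleC c (x + y) = scaleC c x + scaleC c y" "scaleC c (x - y) = scaleC c x - scaleC c y"
  "scaleC c (scaleC d x) = scaleC (c * d) x" "scaleC 1 x = x" "scaleC 0 x = 0" "scaleC c 0 = 0"
  "scaleC c (- x) = - scaleC c x"
  by (auto intro!: ell2_eqI simp: algebra_simps)

lemma scaleC_add_left: "scaleC (c + d) x = scaleC c x + scaleC d x"
  by (auto intro!: ell2_eqI simp: algebra_simps)

lemma scaleC_of_real [simp]: "scaleC (complex_of_real r) x = r *\<^sub>R x"
  by (auto intro!: ell2_eqI)

lemma cinner_sums: "(\<lambda>n. cnj (coord x n) * coord y n) sums cinner x y"
proof -
  have "summable (\<lambda>n. cmod (cnj (coord x n) * coord y n))"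
  proof (rule summable_comparison_test')
    show "summable (\<lambda>n. (cmod (coord x n))\<^sup>2 + (cmod (coord y n))\<^sup>2)"
      by (intro summable_add coord_square_summable)
    show "norm (cmod (cnj (coord x n) * coord y n)) \<le> (cmod (coord x n))\<^sup>2 + (cmod (coord y n))\<^sup>2" for n
    proof -
      have "2 * (cmod (coord x n) * cmod (coord y n)) \<le> (cmod (coord x n))\<^sup>2 + (cmod (coord y n))\<^sup>2"
        using sum_squares_bound[of "cmod (coord x n)" "cmod (coord y n)"] by (simp add: mult.assoc)
      moreover have "0 \<le> cmod (coord x n) * cmod (coord y n)" by simp
      ultimately have "cmod (coord x n) * cmod (coord y n) \<le> (cmod (coord x n))\<^sup>2 + (cmod (coord y n))\<^sup>2"
        by linarith
      then show ?thesis by (simp add: norm_mult)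
    qed
  qed
  then show ?thesis
    unfolding cinner_def by (intro summable_sums) (rule summable_norm_cancel)
qed

lemma Re_cinner: "Re (cinner x y) = x \<bullet> y"
proof -
  have "(\<lambda>n. Re (cnj (coord x n) * coord y n)) sums (x \<bullet> y)"
    using inner_ell2_sums[of x y] by (simp add: inner_complex_def)
  then show ?thesis
    using sums_unique2[OF sums_Re[OF cinner_sums]] by blast
qed

text \<open>The imaginary part is again a real inner product, taken against i x. Additivity of
  \<open>cinner\<close> can thus be read off the \<open>real_inner\<close> instance, with no further
  manipulation of series.\<close>

lemma cinner_eq: "cinner x y = Complex (x \<bullet> y) (scaleC \<i> x \<bullet> y)"
proof -
  have "(\<lambda>n. Im (cnj (coord x n) * coord y n)) sums (scaleC \<i> x \<bullet> y)"
    using inner_ell2_sums[of "scaleC \<i> x" y] by (simp add: inner_complex_def)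
  then have "Im (cinner x y) = scaleC \<i> x \<bullet> y"
    using sums_unique2[OF sums_Im[OF cinner_sums]] by blast
  then show ?thesis by (simp add: complex_eq_iff Re_cinner)
qed

lemma cinner_commute: "cinner x y = cnj (cinner y x)"
proof -
  have "(\<lambda>n. cnj (cnj (coord y n) * coord x n)) sums cnj (cinner y x)"
    unfolding sums_cnj by (rule cinner_sums)
  then show ?thesis
    using sums_unique2[OF cinner_sums[of x y]] by (simp add: mult.commute)
qed

lemma cinner_add_right: "cinner x (y + z) = cinner x y + cinner x z"
  by (simp add: cinner_eq inner_add_right complex_eq_iff)

lemma cinner_diff_right: "cinner x (y - z) = cinner x y - cinner x z"
  by (simp add: cinner_eq inner_diff_right complex_eq_iff)

lemma cinner_scaleC_right: "cinner x (scaleC c y) = c * cinner x y"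
proof -
  have "(\<lambda>n. c * (cnj (coord x n) * coord y n)) sums (c * cinner x y)"
    by (intro sums_mult cinner_sums)
  then show ?thesis
    using sums_unique2[OF cinner_sums[of x "scaleC c y"]] by (simp add: algebra_simps)
qed

lemma cinner_scaleR_right: "cinner x (r *\<^sub>R y) = complex_of_real r * cinner x y"
  using cinner_scaleC_right[of x "complex_of_real r" y] by simp

lemma cinner_zero [simp]: "cinner x 0 = 0" "cinner 0 x = 0"
  by (simp_all add: cinner_def)

lemma cinner_add_left: "cinner (x + y) z = cinner x z + cinner y z"
  by (subst (1 2 3) cinner_commute) (simp add: cinner_add_right)

lemma cinner_diff_left: "cinner (x - y) z = cinner x z - cinner y z"
  by (subst (1 2 3) cinner_commute) (simp add: cinner_diff_right)

lemma cinner_scaleC_left: "cinner (scaleC c x) y = cnj c * cinner x y"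
  by (subst (1 2) cinner_commute) (simp add: cinner_scaleC_right)

lemma cinner_self: "cinner x x = complex_of_real ((norm x)\<^sup>2)"
proof -
  have "cinner x x = cnj (cinner x x)" by (rule cinner_commute)
  then have "Im (cinner x x) = 0" by (simp add: complex_eq_iff)
  then show ?thesis by (simp add: complex_eq_iff Re_cinner power2_norm_eq_inner)
qed

lemma norm_cinner_le: "cmod (cinner x y) \<le> norm x * norm y"
proof (cases "cinner x y = 0")
  case False
  \<comment> \<open>The phase \<open>u\<close> rotates \<open>cinner x y\<close> onto the positive
    real axis, where it equals a real inner product and the real Cauchy-Schwarz inequality
    applies.\<close>
  define u where "u = cnj (cinner x y) / complex_of_real (cmod (cinner x y))"
  have nu: "cmod u = 1" using False by (simp add: u_def norm_divide)
  have "cinner x (scaleC u y) = complex_of_real (cmod (cinner x y))"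
    using False complex_norm_square[of "cinner x y"]
    by (simp add: cinner_scaleC_right u_def power2_eq_square mult.commute divide_eq_eq)
  then have "cmod (cinner x y) = x \<bullet> scaleC u y"
    by (metis Re_cinner Re_complex_of_real)
  also have "\<dots> \<le> norm x * norm (scaleC u y)" by (rule norm_cauchy_schwarz)
  finally show ?thesis by (simp add: norm_scaleC nu)
qed simp

lemma cinner_basis_vec: "cinner (basis_vec n) x = coord x n"
proof -
  have "(\<lambda>k. cnj (coord (basis_vec n) k) * coord x k) = (\<lambda>k. if k = n then coord x k else 0)"
    by (auto simp: fun_eq_iff)
  then show ?thesis
    using sums_unique2[OF cinner_sums[of "basis_vec n" x]] sums_single[of n "\<lambda>k. coord x k"]
    by simp
qed

lemma norm_basis_vec [simp]: "norm (basis_vec n) = 1"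
proof -
  have "complex_of_real ((norm (basis_vec n))\<^sup>2) = 1"
    by (simp add: cinner_self[symmetric] cinner_basis_vec del: of_real_power)
  then have "(norm (basis_vec n))\<^sup>2 = 1\<^sup>2" by (metis of_real_eq_1_iff one_power2)
  then show ?thesis by (rule power2_eq_imp_eq) auto
qed

lemma cinner_eqI: "(\<And>y. cinner y x = cinner y x') \<Longrightarrow> x = x'"
  by (metis cinner_basis_vec ell2_eqI)

section \<open>Finite truncations and adjoints\<close>

definition trunc :: "nat \<Rightarrow> (nat \<Rightarrow> complex) \<Rightarrow> ell2" where
  "trunc N f = (\<Sum>n<N. scaleC (f n) (basis_vec n))"

lemma coord_sum: "coord (sum g I) n = (\<Sum>i\<in>I. coord (g i) n)"
  by (induction I rule: infinite_finite_induct) auto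

lemma coord_trunc: "coord (trunc N f) n = (if n < N then f n else 0)"
  unfolding trunc_def by (simp add: coord_sum of_bool_def if_distrib[of "\<lambda>x. _ * x"] cong: if_cong)

lemma norm_trunc: "(norm (trunc N f))\<^sup>2 = (\<Sum>n<N. (cmod (f n))\<^sup>2)"
proof -
  have "(\<lambda>n. (cmod (coord (trunc N f) n))\<^sup>2) = (\<lambda>n. if n \<in> {..<N} then (cmod (f n))\<^sup>2 else 0)"
    by (auto simp: coord_trunc)
  then show ?thesis
    using sums_unique2[OF norm_ell2_sums[of "trunc N f"]]
      sums_If_finite_set[of "{..<N}" "\<lambda>n. (cmod (f n))\<^sup>2"] by simp
qed

lemma trunc_tendsto: "(\<lambda>N. trunc N (coord x)) \<longlonglongrightarrow> x"
proof -
  have "(norm (x - trunc N (coord x)))\<^sup>2 = (norm x)\<^sup>2 - (\<Sum>n<N. (cmod (coord x n))\<^sup>2)" for N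
  proof -
    have "(\<lambda>n. (cmod (coord x n))\<^sup>2 - (cmod (coord (trunc N (coord x)) n))\<^sup>2)
        sums ((norm x)\<^sup>2 - (norm (trunc N (coord x)))\<^sup>2)"
      by (intro sums_diff norm_ell2_sums)
    moreover have "(\<lambda>n. (cmod (coord x n))\<^sup>2 - (cmod (coord (trunc N (coord x)) n))\<^sup>2)
      = (\<lambda>n. (cmod (coord (x - trunc N (coord x)) n))\<^sup>2)"
      by (auto simp: coord_trunc)
    ultimately show ?thesis
      using sums_unique2[OF norm_ell2_sums[of "x - trunc N (coord x)"]] by (simp add: norm_trunc)
  qed
  moreover have "(\<lambda>N. (norm x)\<^sup>2 - (\<Sum>n<N. (cmod (coord x n))\<^sup>2)) \<longlonglongrightarrow> (norm x)\<^sup>2 - (norm x)\<^sup>2"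
    using norm_ell2_sums[of x] by (intro tendsto_intros) (simp add: sums_def)
  ultimately have "(\<lambda>N. (norm (x - trunc N (coord x)))\<^sup>2) \<longlonglongrightarrow> 0" by simp
  then have "(\<lambda>N. sqrt ((norm (x - trunc N (coord x)))\<^sup>2)) \<longlonglongrightarrow> sqrt 0"
    by (rule tendsto_real_sqrt)
  then have "(\<lambda>N. norm (trunc N (coord x) - x)) \<longlonglongrightarrow> 0"
    by (simp add: norm_minus_commute)
  then show ?thesis using Lim_null tendsto_norm_zero_iff by blast
qed

lemma carrier_B_ell2: "T \<in> carrier B_ell2 \<longleftrightarrow> (\<forall>c x. T (scaleC c x) = scaleC c (T x))"
  by (simp add: B_ell2_def)

lemma blinfun_scaleC: "T \<in> carrier B_ell2 \<Longrightarrow> T (scaleC c x) = scaleC c (T x)"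
  by (simp add: carrier_B_ell2)

lemma cinner_blinfun_trunc:
  assumes "T \<in> carrier B_ell2"
  shows "cinner x (T (trunc N f)) = (\<Sum>n<N. f n * cinner x (T (basis_vec n)))"
  by (induction N)
    (simp_all add: trunc_def blinfun.add_right blinfun_scaleC[OF assms] cinner_add_right cinner_scaleC_right)

text \<open>The adjoint has the coordinates that \<open>T* x\<close> must have against the basis vectors; testing
  \<open>T\<close> on its own truncation shows that they are square summable.\<close>

lemma adjoint_exists:
  assumes T: "T \<in> carrier B_ell2"
  shows "\<exists>S\<in>carrier B_ell2. \<forall>x y. cinner (S x) y = cinner x (T y)"
proof -
  have "\<exists>z. coord z = (\<lambda>n. cinner (T (basis_vec n)) x) \<and> norm z \<le> norm T * norm x" for x
  proof -
    define f where "f = (\<lambda>n. cinner (T (basis_vec n)) x)"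
    have cf: "cnj (f n) = cinner x (T (basis_vec n))" for n
      unfolding f_def by (rule cinner_commute[symmetric])
    have "(\<Sum>n<N. (cmod (f n))\<^sup>2) \<le> (norm T * norm x)\<^sup>2" for N
    proof -
      define r where "r = norm (trunc N f)"
      have "complex_of_real (r\<^sup>2) = cinner x (T (trunc N f))"
        unfolding cinner_blinfun_trunc[OF T] r_def norm_trunc
        by (simp add: cf[symmetric] complex_norm_square del: of_real_power)
      then have "r\<^sup>2 \<le> norm x * norm (T (trunc N f))"
        using norm_cinner_le[of x "T (trunc N f)"] by (metis norm_of_real abs_power2)
      also have "\<dots> \<le> norm x * (norm T * r)"
        unfolding r_def by (intro mult_left_mono norm_blinfun) simp
      finally have "r * r \<le> (norm T * norm x) * r" by (simp add: power2_eq_square algebra_simps)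
      moreover have "r \<ge> 0" by (simp add: r_def)
      ultimately have "r \<le> norm T * norm x"
        by (cases "r = 0") (auto dest: mult_right_le_imp_le)
      then have "r\<^sup>2 \<le> (norm T * norm x)\<^sup>2" using \<open>0 \<le> r\<close> by (rule power_mono)
      then show ?thesis unfolding r_def norm_trunc .
    qed
    then obtain z where "coord z = f" "(norm z)\<^sup>2 \<le> (norm T * norm x)\<^sup>2"
      by (rule square_summable_ell2I)
    then show ?thesis unfolding f_def by (metis power2_le_imp_le mult_nonneg_nonneg norm_ge_zero)
  qed
  then obtain g where g: "\<And>x n. coord (g x) n = cinner (T (basis_vec n)) x"
    "\<And>x. norm (g x) \<le> norm T * norm x" by metis
  have "bounded_linear g"
    by (rule bounded_linear_intro[where K = "norm T"])
      (auto intro!: ell2_eqI simp: g cinner_add_right cinner_scaleR_right mult.commute[of "norm _" "norm T"])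
  then have S: "blinfun_apply (Blinfun g) = g" by (simp add: bounded_linear_Blinfun_apply)
  have "Blinfun g \<in> carrier B_ell2"
    by (auto intro!: ell2_eqI simp: carrier_B_ell2 S g cinner_scaleC_right)
  moreover have "cinner (g x) y = cinner x (T y)" for x y
  proof -
    have "(\<lambda>N. T (trunc N (coord y))) \<longlonglongrightarrow> T y"
      by (intro blinfun.tendsto tendsto_const trunc_tendsto)
    moreover have "bounded_linear (cinner x)"
      by (rule bounded_linear_intro[where K = "norm x"])
        (auto simp: cinner_add_right cinner_scaleR_right scaleR_conv_of_real norm_cinner_le mult.commute[of "norm _" "norm x"])
    ultimately have "(\<lambda>N. cinner x (T (trunc N (coord y)))) \<longlonglongrightarrow> cinner x (T y)"
      by (rule bounded_linear.tendsto[rotated])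
    moreover have "(\<lambda>N. cinner x (T (trunc N (coord y)))) \<longlonglongrightarrow> cinner (g x) y"
      unfolding cinner_blinfun_trunc[OF T]
      using cinner_sums[of "g x" y] by (simp add: sums_def g cinner_commute[symmetric] mult.commute)
    ultimately show ?thesis using LIMSEQ_unique by blast
  qed
  ultimately show ?thesis using S by metis
qed

text \<open>As \<open>adjoint_op\<close> is a definite description, identities for it are proved by
  exhibiting an operator with the defining property; inner products separate vectors.\<close>

lemma adjoint_op_unique:
  assumes "\<And>x y. cinner (blinfun_apply S x) y = cinner x (blinfun_apply T y)"
  shows "adjoint_op T = S"
  unfolding adjoint_op_def
proof (rule the_equality)
  show "\<forall>x y. cinner (S x) y = cinner x (T y)" using assms by blast
  fix S' :: "ell2 \<Rightarrow>\<^sub>L ell2" assume S': "\<forall>x y. cinner (S' x) y = cinner x (T y)"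
  have "cinner y (S' x) = cinner y (S x)" for x y
    using S' assms by (metis cinner_commute)
  then show "S' = S" by (intro blinfun_eqI cinner_eqI)
qed

lemma
  assumes "T \<in> carrier B_ell2"
  shows adjoint_op_closed: "adjoint_op T \<in> carrier B_ell2"
    and cinner_adjoint_left: "cinner (adjoint_op T x) y = cinner x (T y)"
    and cinner_adjoint_right: "cinner x (adjoint_op T y) = cinner (T x) y"
proof -
  obtain S where "S \<in> carrier B_ell2" "\<And>x y. cinner (S x) y = cinner x (T y)"
    using adjoint_exists[OF assms] by blast
  with adjoint_op_unique[of S T]
  show "adjoint_op T \<in> carrier B_ell2" and *: "cinner (adjoint_op T x) y = cinner x (T y)" for x y
    by auto
  show "cinner x (adjoint_op T y) = cinner (T x) y"
    by (metis * cinner_commute)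
qed

section \<open>The C*-algebra of bounded operators\<close>

lemma B_ell2_simps [simp]:
  "x \<otimes>\<^bsub>B_ell2\<^esub> y = x o\<^sub>L y" "\<one>\<^bsub>B_ell2\<^esub> = id_blinfun" "\<zero>\<^bsub>B_ell2\<^esub> = 0"
  "x \<oplus>\<^bsub>B_ell2\<^esub> y = x + y" "c \<odot>\<^bsub>B_ell2\<^esub> x = scaleC_op c o\<^sub>L x"
  "involution B_ell2 = adjoint_op" "cnorm B_ell2 = norm"
  by (simp_all add: B_ell2_def)

lemma scaleC_op_apply [simp]: "scaleC_op c x = scaleC c x"
  by (simp add: scaleC_op.rep_eq)

lemma carrier_closed [simp, intro]:
  "0 \<in> carrier B_ell2" "id_blinfun \<in> carrier B_ell2"
  "x \<in> carrier B_ell2 \<Longrightarrow> y \<in> carrier B_ell2 \<Longrightarrow> x + y \<in> carrier B_ell2"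
  "x \<in> carrier B_ell2 \<Longrightarrow> y \<in> carrier B_ell2 \<Longrightarrow> x - y \<in> carrier B_ell2"
  "x \<in> carrier B_ell2 \<Longrightarrow> - x \<in> carrier B_ell2"
  "x \<in> carrier B_ell2 \<Longrightarrow> y \<in> carrier B_ell2 \<Longrightarrow> x o\<^sub>L y \<in> carrier B_ell2"
  "scaleC_op c \<in> carrier B_ell2"
  "x \<in> carrier B_ell2 \<Longrightarrow> adjoint_op x \<in> carrier B_ell2"
  by (auto simp: carrier_B_ell2 blinfun.bilinear_simps mult.commute intro: adjoint_op_closed[unfolded carrier_B_ell2, rule_format])

lemma complex_ring_cring: "cring complex_ring"
  unfolding complex_ring_def
  by unfold_locales
    (auto simp: Units_def algebra_simps intro: exI[of _ "- _ :: complex"] ab_left_minus)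

lemma ring_B_ell2: "ring B_ell2"
proof (rule ringI)
  show "abelian_group B_ell2"
  proof (rule abelian_groupI)
    fix x assume "x \<in> carrier B_ell2"
    then show "\<exists>y\<in>carrier B_ell2. y \<oplus>\<^bsub>B_ell2\<^esub> x = \<zero>\<^bsub>B_ell2\<^esub>"
      by (intro bexI[of _ "- x"]) auto
  qed auto
  show "Group.monoid B_ell2"
    by (rule monoidI) (auto intro!: blinfun_eqI)
qed (auto intro!: blinfun_eqI simp: blinfun.bilinear_simps)

interpretation B_ell2: ring B_ell2 by (rule ring_B_ell2)

lemma B_ell2_a_inv [simp]: "x \<in> carrier B_ell2 \<Longrightarrow> \<ominus>\<^bsub>B_ell2\<^esub> x = - x"
  by (rule B_ell2.minus_equality) auto

lemma B_ell2_minus [simp]: "y \<in> carrier B_ell2 \<Longrightarrow> x \<ominus>\<^bsub>B_ell2\<^esub> y = x - y"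
  by (simp add: a_minus_def)

lemma B_ell2_finsum:
  "finite I \<Longrightarrow> f \<in> I \<rightarrow> carrier B_ell2 \<Longrightarrow> finsum B_ell2 f I = sum f I"
  by (induction I rule: finite_induct) (auto simp: Pi_def)

lemma B_ell2_inv_eq:
  assumes "y \<in> carrier B_ell2" "x o\<^sub>L y = id_blinfun" "y o\<^sub>L x = id_blinfun"
  shows "inv\<^bsub>B_ell2\<^esub> x = y"
  unfolding m_inv_def
proof (rule the_equality)
  fix z assume z: "z \<in> carrier B_ell2 \<and> x \<otimes>\<^bsub>B_ell2\<^esub> z = \<one>\<^bsub>B_ell2\<^esub> \<and> z \<otimes>\<^bsub>B_ell2\<^esub> x = \<one>\<^bsub>B_ell2\<^esub>"
  then have "z v = y v" for v
    using assms blinfun_apply_blinfun_compose id_blinfun.rep_eq B_ell2_simps(1,2) by metis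
  then show "z = y" by (rule blinfun_eqI)
qed (use assms in auto)

lemma adjoint_op_adjoint_op: "x \<in> carrier B_ell2 \<Longrightarrow> adjoint_op (adjoint_op x) = x"
  by (rule adjoint_op_unique) (simp add: cinner_adjoint_right)

lemma adjoint_op_add:
  "x \<in> carrier B_ell2 \<Longrightarrow> y \<in> carrier B_ell2 \<Longrightarrow> adjoint_op (x + y) = adjoint_op x + adjoint_op y"
  by (rule adjoint_op_unique)
    (simp add: blinfun.bilinear_simps cinner_add_left cinner_add_right cinner_adjoint_left)

lemma adjoint_op_compose:
  "x \<in> carrier B_ell2 \<Longrightarrow> y \<in> carrier B_ell2 \<Longrightarrow> adjoint_op (x o\<^sub>L y) = adjoint_op y o\<^sub>L adjoint_op x"
  by (rule adjoint_op_unique) (simp add: cinner_adjoint_left)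

lemma adjoint_op_scaleC_op: "adjoint_op (scaleC_op c) = scaleC_op (cnj c)"
  by (rule adjoint_op_unique) (simp add: cinner_scaleC_left cinner_scaleC_right)

text \<open>Cauchy-Schwarz bounds the square of norm y by the norm of y* y, which is at most the
  product of the norms of y* and y. Cancelling gives norm y at most norm y*; the same for the
  adjoint of x closes the circle.\<close>

lemma norm_adjoint_op_compose:
  assumes x: "x \<in> carrier B_ell2"
  shows "norm (adjoint_op x o\<^sub>L x) = (norm x)\<^sup>2"
proof -
  have sq: "(norm (y v))\<^sup>2 \<le> norm (adjoint_op y o\<^sub>L y) * (norm v)\<^sup>2" if y: "y \<in> carrier B_ell2" for y v
  proof -
    have "complex_of_real ((norm (y v))\<^sup>2) = cinner v ((adjoint_op y o\<^sub>L y) v)"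
      by (simp add: cinner_adjoint_right[OF y] cinner_self)
    then have "(norm (y v))\<^sup>2 \<le> norm v * norm ((adjoint_op y o\<^sub>L y) v)"
      using norm_cinner_le[of v "(adjoint_op y o\<^sub>L y) v"] by (metis norm_of_real abs_power2)
    also have "\<dots> \<le> norm v * (norm (adjoint_op y o\<^sub>L y) * norm v)"
      by (intro mult_left_mono norm_blinfun) simp
    finally show ?thesis by (simp add: power2_eq_square algebra_simps)
  qed
  have up: "(norm y)\<^sup>2 \<le> norm (adjoint_op y o\<^sub>L y)" if y: "y \<in> carrier B_ell2" for y
  proof -
    have "norm y \<le> sqrt (norm (adjoint_op y o\<^sub>L y))"
    proof (rule norm_blinfun_bound)
      show "norm (y v) \<le> sqrt (norm (adjoint_op y o\<^sub>L y)) * norm v" for v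
        using real_sqrt_le_mono[OF sq[OF y, of v]] by (simp add: real_sqrt_mult)
    qed simp
    then show ?thesis by (simp add: sqrt_ge_absD)
  qed
  have ad: "norm y \<le> norm (adjoint_op y)" if y: "y \<in> carrier B_ell2" for y
  proof (cases "norm y = 0")
    case False
    have "norm y * norm y \<le> norm (adjoint_op y) * norm y"
      using order_trans[OF up[OF y] norm_blinfun_compose] by (simp add: power2_eq_square)
    then show ?thesis using False by (auto dest: mult_right_le_imp_le)
  qed simp
  have "norm (adjoint_op x) \<le> norm x"
    using ad[of "adjoint_op x"] x by (simp add: adjoint_op_adjoint_op)
  then have "norm (adjoint_op x o\<^sub>L x) \<le> norm x * norm x"
    by (intro order_trans[OF norm_blinfun_compose] mult_right_mono) auto
  with up[OF x] show ?thesis by (simp add: power2_eq_square)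
qed

lemma norm_scaleC_op_compose: "norm (scaleC_op c o\<^sub>L x) = cmod c * norm x"
proof -
  have le: "norm (scaleC_op c o\<^sub>L x) \<le> cmod c * norm x" for c x
  proof (rule norm_blinfun_bound)
    show "norm ((scaleC_op c o\<^sub>L x) v) \<le> cmod c * norm x * norm v" for v
      by (simp add: norm_scaleC mult.assoc mult_left_mono norm_blinfun)
  qed simp
  show ?thesis
  proof (cases "c = 0")
    case False
    \<comment> \<open>The reverse inequality is the bound \<open>le\<close> for the inverse
      scalar.\<close>
    have "x = scaleC_op (1 / c) o\<^sub>L (scaleC_op c o\<^sub>L x)"
      using False by (intro blinfun_eqI) simp
    then have "norm x \<le> cmod (1 / c) * norm (scaleC_op c o\<^sub>L x)"
      using le by metis
    then have "cmod c * norm x \<le> norm (scaleC_op c o\<^sub>L x)"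
      using False by (simp add: norm_divide field_simps)
    with le[of c x] show ?thesis by simp
  qed (use le[of 0 x] in simp)
qed

text \<open>Complex linearity is an intersection of equations between evaluations that are
  continuous in \<open>T\<close>. Hence limits of Cauchy sequences stay in the carrier.\<close>

lemma closed_carrier_B_ell2: "closed (carrier B_ell2)"
proof -
  have "carrier B_ell2 = (\<Inter>c. \<Inter>x. {T :: ell2 \<Rightarrow>\<^sub>L ell2. T (scaleC c x) = scaleC c (T x)})"
    by (auto simp: B_ell2_def)
  moreover have "closed {T :: ell2 \<Rightarrow>\<^sub>L ell2. T (scaleC c x) = scaleC c (T x)}" for c x
  proof -
    have "continuous_on UNIV (\<lambda>T :: ell2 \<Rightarrow>\<^sub>L ell2. scaleC c (T x))"
      by (intro bounded_linear.continuous_on[OF bounded_linear_scaleC] continuous_intros)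
    moreover have "continuous_on UNIV (\<lambda>T :: ell2 \<Rightarrow>\<^sub>L ell2. T (scaleC c x))"
      by (intro continuous_intros)
    ultimately show ?thesis by (intro closed_Collect_eq)
  qed
  ultimately show ?thesis by (simp only:) (intro closed_INT ballI)
qed

lemma cstar_algebra_B_ell2: "cstar_algebra B_ell2"
proof -
  have "abelian_group B_ell2" by (rule B_ell2.abelian_group_axioms)
  with complex_ring_cring have "module complex_ring B_ell2"
    by (rule moduleI)
      (auto intro!: blinfun_eqI simp: complex_ring_def blinfun.bilinear_simps scaleC_add_left)
  then interpret module complex_ring B_ell2 .
  show ?thesis
  proof
    show "\<exists>L\<in>carrier B_ell2. (\<lambda>n. cnorm B_ell2 (X n \<ominus>\<^bsub>B_ell2\<^esub> L)) \<longlonglongrightarrow> 0"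
      if X: "range X \<subseteq> carrier B_ell2"
        and C: "\<forall>e>0. \<exists>N. \<forall>m\<ge>N. \<forall>n\<ge>N. cnorm B_ell2 (X m \<ominus>\<^bsub>B_ell2\<^esub> X n) < e" for X
    proof -
      have [simp]: "X n \<in> carrier B_ell2" for n using X by auto
      have "Cauchy X" unfolding Cauchy_def using C by (simp add: dist_norm)
      then obtain L where L: "X \<longlonglongrightarrow> L" using Cauchy_convergent convergent_def by blast
      then have "L \<in> carrier B_ell2"
        using closed_sequentially[OF closed_carrier_B_ell2, of X L] by simp
      then show ?thesis using tendsto_norm_zero[OF LIM_zero[OF L]] by (intro bexI[of _ L]) auto
    qed
  qed (auto simp: adjoint_op_adjoint_op adjoint_op_add adjoint_op_scaleC_op adjoint_op_compose
      norm_adjoint_op_compose norm_scaleC_op_compose blinfun_scaleC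
      norm_triangle_ineq norm_blinfun_compose intro!: blinfun_eqI)
qed

text \<open>If \<open>Im x \<ge> e\<close>, then \<open>1 + i t x\<close> is a strict contraction for small \<open>t > 0\<close>.\<close>

lemma imaginary_bound_invertible:
  assumes x: "x \<in> carrier B_ell2" and "e > 0"
    and im: "\<And>v. e * (norm v)\<^sup>2 \<le> Im (cinner v (x v))"
  obtains y where "y \<in> carrier B_ell2" "x o\<^sub>L y = id_blinfun" "y o\<^sub>L x = id_blinfun"
proof -
  define n where "n = norm x + e"
  have n: "n > 0" "n \<ge> e" "norm x \<le> n" using \<open>e > 0\<close> by (auto simp: n_def add_nonneg_pos)
  \<comment> \<open>The squared norm of v + i t x v is at most (1 - 2 t e + t^2 n^2) times that of
    v. This \<open>t\<close> minimizes the factor, leaving 1 - e^2 / n^2, the square of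
    \<open>q\<close>; adding \<open>e\<close> in \<open>n\<close> keeps n positive and the factor
    nonnegative.\<close>
  define t where "t = e / n\<^sup>2"
  have t: "t > 0" using n \<open>e > 0\<close> by (simp add: t_def)
  define q where "q = sqrt (1 - e\<^sup>2 / n\<^sup>2)"
  have en: "0 < e\<^sup>2 / n\<^sup>2" "e\<^sup>2 / n\<^sup>2 \<le> 1" using n \<open>e > 0\<close> by (auto simp: divide_le_eq_1 power_mono)
  have q: "0 \<le> q" "q < 1" "q\<^sup>2 = 1 - e\<^sup>2 / n\<^sup>2"
    using en unfolding q_def by (auto simp: real_sqrt_lt_1_iff)
  have contr: "norm (v + scaleC (\<i> * complex_of_real t) (x v)) \<le> q * norm v" for v
  proof -
    have "(norm (x v))\<^sup>2 \<le> (n * norm v)\<^sup>2"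
      using order_trans[OF norm_blinfun[of x v] mult_right_mono[OF n(3)]] by (intro power_mono) auto
    then have b: "t\<^sup>2 * (norm (x v))\<^sup>2 \<le> e\<^sup>2 / n\<^sup>2 * (norm v)\<^sup>2"
      using n(1) mult_left_mono[of "(norm (x v))\<^sup>2" "(n * norm v)\<^sup>2" "t\<^sup>2"]
      by (simp add: t_def power_mult_distrib power_divide field_simps power2_eq_square)
    have c: "t * (e * (norm v)\<^sup>2) \<le> t * Im (cinner v (x v))" using im t by (intro mult_left_mono) auto
    have d: "t * (e * (norm v)\<^sup>2) = e\<^sup>2 / n\<^sup>2 * (norm v)\<^sup>2" by (simp add: t_def power2_eq_square)
    define w where "w = scaleC (\<i> * complex_of_real t) (x v)"
    have vw: "v \<bullet> w = - (t * Im (cinner v (x v)))"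
      unfolding Re_cinner[symmetric] w_def by (simp add: cinner_scaleC_right)
    have nw: "w \<bullet> w = t\<^sup>2 * (norm (x v))\<^sup>2"
      using t by (simp add: w_def norm_scaleC norm_mult power_mult_distrib flip: power2_norm_eq_inner)
    have "(norm (v + scaleC (\<i> * complex_of_real t) (x v)))\<^sup>2
        = (norm v)\<^sup>2 - 2 * (t * Im (cinner v (x v))) + t\<^sup>2 * (norm (x v))\<^sup>2"
      unfolding w_def[symmetric] using vw nw
      by (simp add: power2_norm_eq_inner inner_add_left inner_add_right inner_commute)
    also have "\<dots> \<le> (q * norm v)\<^sup>2"
      using b c d unfolding power_mult_distrib q(3) by (simp add: algebra_simps)
    finally show ?thesis by (rule power2_le_imp_le) (use q in simp)
  qed
  have solve: "\<exists>v. x v = w" for w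
  proof -
    \<comment> \<open>At a fixed point of \<open>f\<close> the correction i t (x v - w) vanishes, so
      v solves x v = w; the contraction factor is \<open>q\<close>.\<close>
    define f where "f v = (v + scaleC (\<i> * complex_of_real t) (x v)) - scaleC (\<i> * complex_of_real t) w" for v
    have "f v - f v' = (v - v') + scaleC (\<i> * complex_of_real t) (x (v - v'))" for v v'
      unfolding f_def by (simp add: blinfun.diff_right)
    then have "\<forall>v v'. dist (f v) (f v') \<le> q * dist v v'"
      using contr by (simp add: dist_norm)
    from banach_fix_type[OF q(1,2) this] obtain v where "f v = v" by blast
    then have "scaleC (\<i> * complex_of_real t) (x v) = scaleC (\<i> * complex_of_real t) w"
      by (simp add: f_def algebra_simps)
    then have "scaleC (1 / (\<i> * complex_of_real t)) (scaleC (\<i> * complex_of_real t) (x v))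
        = scaleC (1 / (\<i> * complex_of_real t)) (scaleC (\<i> * complex_of_real t) w)" by (rule arg_cong)
    then show ?thesis using t by auto
  qed
  \<comment> \<open>Boundedness below gives injectivity of \<open>x\<close> and the norm bound for
    its inverse.\<close>
  have below: "norm v \<le> norm (x v) / e" for v
  proof (cases "v = 0")
    case False
    have "e * (norm v)\<^sup>2 \<le> norm v * norm (x v)"
      using im[of v] abs_Im_le_cmod[of "cinner v (x v)"] norm_cinner_le[of v "x v"] by linarith
    then have "(e * norm v) * norm v \<le> norm (x v) * norm v"
      by (simp add: power2_eq_square mult_ac)
    then have "e * norm v \<le> norm (x v)"
      by (rule mult_right_le_imp_le) (use False in simp)
    then show ?thesis using \<open>e > 0\<close> by (simp add: field_simps)
  qed simp
  have inj: "v = v'" if "x v = x v'" for v v'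
    using below[of "v - v'"] that by (simp add: blinfun.diff_right)
  define g where "g w = (THE v. x v = w)" for w
  have xg: "x (g w) = w" for w
  proof -
    obtain v where v: "x v = w" using solve by blast
    then have "g w = v" unfolding g_def by (intro the_equality) (auto intro: inj)
    with v show ?thesis by simp
  qed
  have "bounded_linear g"
  proof (rule bounded_linear_intro[where K = "1 / e"])
    show "g (v + w) = g v + g w" for v w by (rule inj) (simp add: xg blinfun.add_right)
    show "g (r *\<^sub>R v) = r *\<^sub>R g v" for r v by (rule inj) (simp add: xg blinfun.scaleR_right)
    show "norm (g v) \<le> norm v * (1 / e)" for v using below[of "g v"] by (simp add: xg)
  qed
  then have Y: "blinfun_apply (Blinfun g) = g" by (simp add: bounded_linear_Blinfun_apply)
  show thesis
  proof (rule that[of "Blinfun g"])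
    show "Blinfun g \<in> carrier B_ell2"
      unfolding carrier_B_ell2 Y by (intro allI, rule inj) (simp add: xg blinfun_scaleC[OF x])
    show "x o\<^sub>L Blinfun g = id_blinfun" by (rule blinfun_eqI) (simp add: Y xg)
    show "Blinfun g o\<^sub>L x = id_blinfun" by (rule blinfun_eqI, rule inj) (simp add: Y xg)
  qed
qed

section \<open>Amplification and the semicircular operator\<close>

text \<open>For injective \<open>g\<close> the adjoint is the isometry taking e_k to e_{g k}. The
  two halves of the index set and the backward shift, \<open>pull Suc\<close>, are all obtained from
  it.\<close>

definition pull :: "(nat \<Rightarrow> nat) \<Rightarrow> ell2 \<Rightarrow>\<^sub>L ell2" where
  "pull g = Blinfun (\<lambda>x. Abs_ell2 (\<lambda>n. coord x (g n)))"

context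
  fixes g :: "nat \<Rightarrow> nat"
  assumes g: "inj g"
begin

lemma coord_pull: "coord (pull g x) n = coord x (g n)"
proof -
  define h where "h x = Abs_ell2 (\<lambda>n. coord x (g n))" for x
  have s: "summable (\<lambda>n. (cmod (coord x (g n)))\<^sup>2)" for x
    using summable_reindex[OF coord_square_summable g] by (simp add: o_def)
  then have h: "coord (h x) n = coord x (g n)" for x n
    by (simp add: h_def Abs_ell2_inverse)
  have "bounded_linear h"
  proof (rule bounded_linear_intro[where K = 1])
    show "norm (h x) \<le> norm x * 1" for x
    proof -
      have "(norm (h x))\<^sup>2 \<le> (norm x)\<^sup>2"
        using suminf_reindex_mono[OF coord_square_summable g, of x] norm_ell2_sums[of x]
          norm_ell2_sums[of "h x"] by (simp add: h o_def sums_iff)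
      then have "norm (h x) \<le> norm x" by (rule power2_le_imp_le) simp
      then show ?thesis by simp
    qed
  qed (auto intro!: ell2_eqI simp: h)
  then have "blinfun_apply (pull g) = h"
    unfolding pull_def h_def[abs_def] by (rule bounded_linear_Blinfun_apply)
  then show ?thesis by (simp add: h)
qed

lemma pull_carrier: "pull g \<in> carrier B_ell2"
  by (auto simp: carrier_B_ell2 coord_pull intro!: ell2_eqI)

lemma pull_basis_vec: "pull g (basis_vec (g k)) = basis_vec k"
  using g by (auto simp: coord_pull inj_eq intro!: ell2_eqI)

lemma coord_push: "coord (adjoint_op (pull g) x) (g n) = coord x n"
  unfolding cinner_basis_vec[of "g n", symmetric] cinner_adjoint_right[OF pull_carrier]
  by (simp add: pull_basis_vec cinner_basis_vec)

lemma coord_push_notin: "m \<notin> range g \<Longrightarrow> coord (adjoint_op (pull g) x) m = 0"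
proof -
  assume "m \<notin> range g"
  then have "pull g (basis_vec m) = 0"
    by (auto simp: coord_pull intro!: ell2_eqI)
  then show ?thesis
    unfolding cinner_basis_vec[of m, symmetric] cinner_adjoint_right[OF pull_carrier] by simp
qed

lemma pull_push: "pull g (adjoint_op (pull g) x) = x"
  by (auto simp: coord_pull coord_push intro!: ell2_eqI)

end

abbreviation even_part :: "ell2 \<Rightarrow>\<^sub>L ell2" where "even_part \<equiv> pull (\<lambda>n. 2 * n)"
abbreviation odd_part :: "ell2 \<Rightarrow>\<^sub>L ell2" where "odd_part \<equiv> pull (\<lambda>n. Suc (2 * n))"
abbreviation even_embed :: "ell2 \<Rightarrow>\<^sub>L ell2" where "even_embed \<equiv> adjoint_op even_part"
abbreviation odd_embed :: "ell2 \<Rightarrow>\<^sub>L ell2" where "odd_embed \<equiv> adjoint_op odd_part"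

lemma inj_even_odd: "inj (\<lambda>n::nat. 2 * n)" "inj (\<lambda>n::nat. Suc (2 * n))"
  by (auto simp: inj_on_def)

lemmas coord_even_odd = inj_even_odd[THEN coord_pull]
lemmas carrier_even_odd [simp] = inj_even_odd[THEN pull_carrier]

text \<open>Together with \<open>even_odd_decomp\<close> these are the Cuntz relations for two
  isometries with complementary ranges. They reduce identities in the tensor picture to rewriting of
  parts.\<close>

lemma even_odd_simps [simp]:
  "even_part (even_embed x) = x" "odd_part (odd_embed x) = x"
  "odd_part (even_embed x) = 0" "even_part (odd_embed x) = 0"
  by (intro pull_push inj_even_odd)+
    (auto intro!: ell2_eqI coord_push_notin simp: coord_even_odd inj_even_odd image_iff, presburger+)

lemma even_odd_eqI:
  assumes "even_part x = even_part y" "odd_part x = odd_part y"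
  shows "x = y"
proof (rule ell2_eqI)
  fix n
  show "coord x n = coord y n"
    using arg_cong[OF assms(1), of "\<lambda>z. coord z (n div 2)"] arg_cong[OF assms(2), of "\<lambda>z. coord z (n div 2)"]
    by (cases "even n") (simp_all add: coord_even_odd)
qed

lemma even_odd_decomp: "even_embed (even_part x) + odd_embed (odd_part x) = x"
  by (rule even_odd_eqI) (simp_all add: blinfun.add_right)

lemma norm_even_odd: "(norm (even_part x))\<^sup>2 + (norm (odd_part x))\<^sup>2 = (norm x)\<^sup>2"
proof -
  have "cinner x (even_embed (even_part x) + odd_embed (odd_part x)) = cinner x x"
    by (simp only: even_odd_decomp)
  then have "complex_of_real ((norm (even_part x))\<^sup>2 + (norm (odd_part x))\<^sup>2) = complex_of_real ((norm x)\<^sup>2)"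
    by (simp add: cinner_add_right cinner_adjoint_right cinner_self)
  then show ?thesis by (simp only: of_real_eq_iff)
qed

text \<open>With the isometries \<open>S = even_embed\<close> and \<open>T = odd_embed\<close>, the vectors
  $T^j S e_k$ are an orthonormal basis and identify \<open>ell2\<close> with \<open>ell2 \<otimes> ell2\<close>. The amplification
  \<open>b \<otimes> 1\<close> satisfies $\iota(b) = S b S^* + T \iota(b) T^*$, which determines its coordinates
  recursively.\<close>

function ampl_coord :: "(ell2 \<Rightarrow>\<^sub>L ell2) \<Rightarrow> ell2 \<Rightarrow> nat \<Rightarrow> complex" where
  "ampl_coord b x n =
     (if even n then coord (b (even_part x)) (n div 2) else ampl_coord b (odd_part x) (n div 2))"
  by auto
termination by (relation "Wellfounded.measure (\<lambda>(b, x, n). n)") (auto elim: oddE)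

declare ampl_coord.simps [simp del]

definition ampl :: "(ell2 \<Rightarrow>\<^sub>L ell2) \<Rightarrow> ell2 \<Rightarrow>\<^sub>L ell2" where
  "ampl b = Blinfun (\<lambda>x. Abs_ell2 (ampl_coord b x))"

lemma sum_even_odd:
  fixes f :: "nat \<Rightarrow> 'a :: comm_monoid_add"
  shows "sum f {..<N} = (\<Sum>k<Suc N div 2. f (2 * k)) + (\<Sum>k<N div 2. f (Suc (2 * k)))"
proof (induction N)
  case (Suc N)
  show ?case
  proof (cases "even N")
    case True
    then obtain M where "N = 2 * M" by auto
    with Suc show ?thesis by (simp add: ac_simps)
  next
    case False
    then obtain M where "N = Suc (2 * M)" by (auto elim: oddE)
    with Suc show ?thesis by (simp add: ac_simps)
  qed
qed simp

text \<open>Even coordinates are controlled by \<open>b\<close> on the even part, odd ones by the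
  induction hypothesis on the odd part, and the squared norms of the two parts add up. Working with
  partial sums keeps the recursion well founded, since N div 2 < N.\<close>

lemma sum_ampl_coord_le: "(\<Sum>n<N. (cmod (ampl_coord b x n))\<^sup>2) \<le> (norm b * norm x)\<^sup>2"
proof (induction N arbitrary: x rule: less_induct)
  case (less N)
  show ?case
  proof (cases "N = 0")
    case False
    have "(\<Sum>k<Suc N div 2. (cmod (ampl_coord b x (2 * k)))\<^sup>2)
        = (\<Sum>k<Suc N div 2. (cmod (coord (b (even_part x)) k))\<^sup>2)"
      by (subst ampl_coord.simps) simp
    also have "\<dots> \<le> (norm (b (even_part x)))\<^sup>2" by (rule sum_coord_le) simp
    also have "\<dots> \<le> (norm b * norm (even_part x))\<^sup>2" by (intro power_mono norm_blinfun) simp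
    finally have 1: "(\<Sum>k<Suc N div 2. (cmod (ampl_coord b x (2 * k)))\<^sup>2) \<le> (norm b * norm (even_part x))\<^sup>2" .
    have "(\<Sum>k<N div 2. (cmod (ampl_coord b x (Suc (2 * k))))\<^sup>2)
        = (\<Sum>k<N div 2. (cmod (ampl_coord b (odd_part x) k))\<^sup>2)"
      by (subst ampl_coord.simps) simp
    also have "\<dots> \<le> (norm b * norm (odd_part x))\<^sup>2" using False by (intro less) simp
    finally have 2: "(\<Sum>k<N div 2. (cmod (ampl_coord b x (Suc (2 * k))))\<^sup>2) \<le> (norm b * norm (odd_part x))\<^sup>2" .
    have "(norm b * norm x)\<^sup>2 = (norm b * norm (even_part x))\<^sup>2 + (norm b * norm (odd_part x))\<^sup>2"
      by (simp add: power_mult_distrib distrib_left[symmetric] norm_even_odd)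
    with 1 2 show ?thesis by (simp only: sum_even_odd[of _ N])
  qed simp
qed

lemma
  shows coord_ampl: "coord (ampl b x) n = ampl_coord b x n"
    and norm_ampl_le: "norm (ampl b) \<le> norm b"
proof -
  define h where "h x = Abs_ell2 (ampl_coord b x)" for x
  have h: "coord (h x) = ampl_coord b x" "norm (h x) \<le> norm b * norm x" for x
  proof -
    obtain y where y: "coord y = ampl_coord b x" "(norm y)\<^sup>2 \<le> (norm b * norm x)\<^sup>2"
      by (rule square_summable_ell2I[OF sum_ampl_coord_le])
    then have "h x = y" unfolding h_def by (metis coord_inverse)
    with y show "coord (h x) = ampl_coord b x" "norm (h x) \<le> norm b * norm x"
      by (auto intro: power2_le_imp_le)
  qed
  have add: "ampl_coord b (x + y) n = ampl_coord b x n + ampl_coord b y n" for x y n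
    by (induction n arbitrary: x y rule: less_induct, subst (1 2 3) ampl_coord.simps)
      (auto simp: blinfun.add_right elim: oddE)
  have scale: "ampl_coord b (r *\<^sub>R x) n = complex_of_real r * ampl_coord b x n" for r x n
    by (induction n arbitrary: x rule: less_induct, subst (1 2) ampl_coord.simps)
      (auto simp: blinfun.scaleR_right elim: oddE)
  have "bounded_linear h"
    by (rule bounded_linear_intro[where K = "norm b"])
      (auto intro!: ell2_eqI simp: h add scale mult.commute[of "norm _" "norm b"])
  then have a: "blinfun_apply (ampl b) = h"
    unfolding ampl_def h_def[abs_def] by (rule bounded_linear_Blinfun_apply)
  then show "coord (ampl b x) n = ampl_coord b x n" by (simp add: h)
  show "norm (ampl b) \<le> norm b" by (rule norm_blinfun_bound) (simp_all add: a h)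
qed

lemma ampl_parts [simp]:
  "even_part (ampl b x) = b (even_part x)" "odd_part (ampl b x) = ampl b (odd_part x)"
  by (rule ell2_eqI, simp add: coord_even_odd coord_ampl, subst ampl_coord.simps, simp)+

lemma ampl_embed [simp]:
  "ampl b (even_embed x) = even_embed (b x)" "ampl b (odd_embed x) = odd_embed (ampl b x)"
  by (rule even_odd_eqI, simp_all)+

text \<open>Each coordinate is reached after finitely many passages to the odd part, so the two
  recursive equations fix the operator. Algebraic properties of \<open>ampl\<close> then follow by
  checking these equations for the candidate.\<close>

lemma ampl_unique:
  fixes R b :: "ell2 \<Rightarrow>\<^sub>L ell2"
  assumes "\<And>x. even_part (R x) = b (even_part x)" "\<And>x. odd_part (R x) = R (odd_part x)"
  shows "ampl b = R"
proof -
  have "coord (R x) n = ampl_coord b x n" for x n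
  proof (induction n arbitrary: x rule: less_induct)
    case (less n)
    show ?case
    proof (cases "even n")
      case True
      then show ?thesis
        using arg_cong[OF assms(1)[of x], of "\<lambda>z. coord z (n div 2)"]
        by (subst ampl_coord.simps) (simp add: coord_even_odd)
    next
      case False
      then have "n div 2 < n" by (auto elim: oddE)
      from less[OF this, of "odd_part x"] False show ?thesis
        using arg_cong[OF assms(2)[of x], of "\<lambda>z. coord z (n div 2)"]
        by (subst ampl_coord.simps) (simp add: coord_even_odd)
    qed
  qed
  then show ?thesis by (intro blinfun_eqI ell2_eqI) (simp add: coord_ampl)
qed

lemma ampl_add: "ampl (b + c) = ampl b + ampl c"
  by (rule ampl_unique) (auto simp: blinfun.bilinear_simps)

lemma ampl_diff: "ampl (b - c) = ampl b - ampl c"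
  by (rule ampl_unique) (auto simp: blinfun.bilinear_simps)

lemma ampl_compose: "ampl (b o\<^sub>L c) = ampl b o\<^sub>L ampl c"
  by (rule ampl_unique) auto

lemma ampl_scaleC_op: "ampl (scaleC_op c) = scaleC_op c"
  by (rule ampl_unique) (auto simp: blinfun_scaleC)

lemma ampl_id: "ampl id_blinfun = id_blinfun"
  by (rule ampl_unique) auto

text \<open>Complex linearity means commuting with every \<open>scaleC_op c\<close>. Since
  \<open>ampl\<close> is multiplicative and fixes these scalars, it transports the
  commutation.\<close>

lemma ampl_carrier [simp, intro]: "b \<in> carrier B_ell2 \<Longrightarrow> ampl b \<in> carrier B_ell2"
proof -
  assume b: "b \<in> carrier B_ell2"
  have "b o\<^sub>L scaleC_op c = scaleC_op c o\<^sub>L b" for c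
    using b by (intro blinfun_eqI) (simp add: blinfun_scaleC)
  then have "(ampl b o\<^sub>L scaleC_op c) x = (scaleC_op c o\<^sub>L ampl b) x" for c x
    by (metis ampl_compose ampl_scaleC_op)
  then show ?thesis
    unfolding carrier_B_ell2 by simp
qed

lemma ampl_adjoint:
  assumes b: "b \<in> carrier B_ell2"
  shows "ampl (adjoint_op b) = adjoint_op (ampl b)"
proof (rule ampl_unique)
  have ev: "cinner y (even_part z) = cinner (even_embed y) z" for y z
    by (rule cinner_adjoint_left[symmetric]) simp
  have od: "cinner y (odd_part z) = cinner (odd_embed y) z" for y z
    by (rule cinner_adjoint_left[symmetric]) simp
  have ad: "cinner y (adjoint_op b z) = cinner (b y) z"
    "cinner y (adjoint_op (ampl b) z) = cinner (ampl b y) z" for y z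
    by (simp_all add: cinner_adjoint_right b ampl_carrier)
  show "even_part (adjoint_op (ampl b) x) = adjoint_op b (even_part x)" for x
    by (rule cinner_eqI) (simp only: ev ad ampl_embed)
  show "odd_part (adjoint_op (ampl b) x) = adjoint_op (ampl b) (odd_part x)" for x
    by (rule cinner_eqI) (simp only: od ad ampl_embed)
qed

section \<open>The conditional expectation and complete positivity\<close>

definition corner :: "(ell2 \<Rightarrow>\<^sub>L ell2) \<Rightarrow> ell2 \<Rightarrow>\<^sub>L ell2" where
  "corner a = even_part o\<^sub>L a o\<^sub>L even_embed"

lemma corner_apply [simp]: "corner a x = even_part (a (even_embed x))"
  by (simp add: corner_def)

lemma corner_carrier [simp, intro]: "a \<in> carrier B_ell2 \<Longrightarrow> corner a \<in> carrier B_ell2"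
  by (simp add: corner_def carrier_closed)

text \<open>The lower bound holds because \<open>b\<close> is recovered from \<open>ampl b\<close>
  by composing with the isometry \<open>even_embed\<close> and the contraction
  \<open>even_part\<close>.\<close>

lemma norm_ampl: "norm (ampl b) = norm b"
proof (rule antisym[OF norm_ampl_le], rule norm_blinfun_bound)
  fix x
  have n: "norm (even_part y) \<le> norm y" for y
    using norm_even_odd[of y] zero_le_power2[of "norm (odd_part y)"]
    by (intro power2_le_imp_le[OF _ norm_ge_zero]) linarith
  have e: "norm (even_embed x) = norm x"
    using norm_even_odd[of "even_embed x"] by (simp add: power2_eq_iff_nonneg)
  have "norm (b x) = norm (even_part (ampl b (even_embed x)))" by simp
  also have "\<dots> \<le> norm (ampl b (even_embed x))" by (rule n)
  also have "\<dots> \<le> norm (ampl b) * norm x" using norm_blinfun[of "ampl b" "even_embed x"] by (simp only: e)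
  finally show "norm (b x) \<le> norm (ampl b) * norm x" .
qed simp

lemma opvalued_space_ampl: "opvalued_space B_ell2 B_ell2 ampl corner"
  unfolding opvalued_space_def
proof (intro conjI)
  show "cstar_algebra B_ell2" "cstar_algebra B_ell2" by (rule cstar_algebra_B_ell2)+
  show "cstar_embedding B_ell2 B_ell2 ampl"
    unfolding cstar_embedding_def cstar_linear_def ring_hom_def
    by (auto simp: ampl_add ampl_compose ampl_scaleC_op ampl_id ampl_adjoint norm_ampl)
  show "conditional_expectation B_ell2 B_ell2 ampl corner"
    unfolding conditional_expectation_def cstar_linear_def
  proof (intro conjI ballI allI)
    fix a :: "ell2 \<Rightarrow>\<^sub>L ell2" assume a: "a \<in> carrier B_ell2"
    show "cstar_positive B_ell2 (corner (involution B_ell2 a \<otimes>\<^bsub>B_ell2\<^esub> a))"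
      unfolding cstar_positive_def
      \<comment> \<open>With S = \<open>even_embed\<close>, the compression S* a* a S is y* y for y
        = a S.\<close>
      by (rule bexI[of _ "a o\<^sub>L even_embed"])
        (use a in \<open>auto simp: corner_def adjoint_op_compose adjoint_op_adjoint_op carrier_closed intro!: blinfun_eqI\<close>)
  qed (auto intro!: blinfun_eqI simp: blinfun.bilinear_simps blinfun_scaleC)
qed

text \<open>Applying V . V* to each entry of X* X gives Y* Y, where Y has the entries
  \<open>X i j\<close> multiplied on the right by V*. The witness is thus explicit.\<close>

lemma completely_positive_compose:
  assumes V: "V \<in> carrier B_ell2"
  shows "completely_positive B_ell2 B_ell2 (\<lambda>a. V \<otimes>\<^bsub>B_ell2\<^esub> a \<otimes>\<^bsub>B_ell2\<^esub> adjoint_op V)"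
  unfolding completely_positive_def
proof (intro conjI allI impI)
  show "cstar_linear B_ell2 B_ell2 (\<lambda>a. V \<otimes>\<^bsub>B_ell2\<^esub> a \<otimes>\<^bsub>B_ell2\<^esub> adjoint_op V)"
    unfolding cstar_linear_def
  proof (intro conjI ballI allI)
    show "V \<otimes>\<^bsub>B_ell2\<^esub> (x \<oplus>\<^bsub>B_ell2\<^esub> y) \<otimes>\<^bsub>B_ell2\<^esub> adjoint_op V
        = V \<otimes>\<^bsub>B_ell2\<^esub> x \<otimes>\<^bsub>B_ell2\<^esub> adjoint_op V \<oplus>\<^bsub>B_ell2\<^esub> V \<otimes>\<^bsub>B_ell2\<^esub> y \<otimes>\<^bsub>B_ell2\<^esub> adjoint_op V" for x y
      by (rule blinfun_eqI) (simp add: blinfun.add_left blinfun.add_right)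
    show "V \<otimes>\<^bsub>B_ell2\<^esub> (c \<odot>\<^bsub>B_ell2\<^esub> x) \<otimes>\<^bsub>B_ell2\<^esub> adjoint_op V
        = c \<odot>\<^bsub>B_ell2\<^esub> (V \<otimes>\<^bsub>B_ell2\<^esub> x \<otimes>\<^bsub>B_ell2\<^esub> adjoint_op V)" for c x
      by (rule blinfun_eqI) (simp add: blinfun_scaleC V)
  qed (use V in auto)
  fix n :: nat and X :: "nat \<Rightarrow> nat \<Rightarrow> ell2 \<Rightarrow>\<^sub>L ell2"
  assume X: "\<forall>i<n. \<forall>j<n. X i j \<in> carrier B_ell2"
  define Y where "Y = (\<lambda>i j. X i j o\<^sub>L adjoint_op V)"
  have gram: "cstar_matrix_gram B_ell2 n Z i j = (\<Sum>k<n. adjoint_op (Z k i) o\<^sub>L Z k j)"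
    if "\<forall>i<n. \<forall>j<n. Z i j \<in> carrier B_ell2" "i < n" "j < n" for Z i j
    unfolding cstar_matrix_gram_def using that by (subst B_ell2_finsum) (auto simp: Pi_def carrier_closed)
  have Y: "\<forall>i<n. \<forall>j<n. Y i j \<in> carrier B_ell2"
    using X V by (simp add: Y_def carrier_closed)
  have "V o\<^sub>L cstar_matrix_gram B_ell2 n X i j o\<^sub>L adjoint_op V = cstar_matrix_gram B_ell2 n Y i j"
    if "i < n" "j < n" for i j
    using X V that unfolding gram[OF X that] gram[OF Y that] unfolding Y_def
    by (auto intro!: blinfun_eqI sum.cong
        simp: blinfun.sum_left blinfun.sum_right adjoint_op_compose adjoint_op_adjoint_op carrier_closed)
  with Y show "\<exists>Y. (\<forall>i<n. \<forall>j<n. Y i j \<in> carrier B_ell2) \<and>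
      (\<forall>i<n. \<forall>j<n. V \<otimes>\<^bsub>B_ell2\<^esub> cstar_matrix_gram B_ell2 n X i j \<otimes>\<^bsub>B_ell2\<^esub> adjoint_op V
        = cstar_matrix_gram B_ell2 n Y i j)"
    by (intro exI[of _ Y]) simp
qed

text \<open>In the picture \<open>ell2 \<otimes> ell2\<close>, this is $D \otimes 1 + V \otimes \ell^* + V^* \otimes \ell$
  with the unilateral shift $\ell$.\<close>

definition semicirc :: "(ell2 \<Rightarrow>\<^sub>L ell2) \<Rightarrow> (ell2 \<Rightarrow>\<^sub>L ell2) \<Rightarrow> ell2 \<Rightarrow>\<^sub>L ell2" where
  "semicirc D V = ampl D + (ampl V o\<^sub>L odd_part) + (odd_embed o\<^sub>L ampl (adjoint_op V))"

context
  fixes D V :: "ell2 \<Rightarrow>\<^sub>L ell2"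
  assumes D: "D \<in> carrier B_ell2" and V: "V \<in> carrier B_ell2" and DD: "adjoint_op D = D"
begin

lemma semicirc_carrier: "semicirc D V \<in> carrier B_ell2"
  using D V by (simp add: semicirc_def carrier_closed)

lemma semicirc_selfadjoint: "adjoint_op (semicirc D V) = semicirc D V"
proof -
  have "adjoint_op (ampl V o\<^sub>L odd_part) = odd_embed o\<^sub>L ampl (adjoint_op V)"
    using V by (simp add: adjoint_op_compose ampl_adjoint)
  moreover have "adjoint_op (odd_embed o\<^sub>L ampl (adjoint_op V)) = ampl V o\<^sub>L odd_part"
    using V by (simp add: adjoint_op_compose ampl_adjoint adjoint_op_adjoint_op carrier_closed)
  ultimately show ?thesis
    using D V unfolding semicirc_def
    by (simp add: adjoint_op_add carrier_closed ampl_adjoint[symmetric] DD)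
qed

text \<open>A self-adjoint operator has a real quadratic form, so subtracting it leaves the lower
  bound on the imaginary part of \<open>ampl b\<close> intact, and that bound gives
  invertibility.\<close>

lemma semicirc_resolvent:
  assumes b: "b \<in> carrier B_ell2" and "e > 0"
    and im: "\<And>v. e * (norm v)\<^sup>2 \<le> Im (cinner v (ampl b v))"
  obtains r where "r \<in> carrier B_ell2" "(ampl b - semicirc D V) o\<^sub>L r = id_blinfun"
    "r o\<^sub>L (ampl b - semicirc D V) = id_blinfun"
    "opvalued_cauchy B_ell2 ampl corner (semicirc D V) b = corner r"
proof -
  let ?s = "semicirc D V"
  have "Im (cinner v (?s v)) = 0" for v
  proof -
    have "cinner v (?s v) = cinner (?s v) v"
      using cinner_adjoint_right[OF semicirc_carrier, of v v] by (simp only: semicirc_selfadjoint)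
    also have "\<dots> = cnj (cinner v (?s v))" by (rule cinner_commute)
    finally show ?thesis by (simp add: complex_eq_iff)
  qed
  then have "e * (norm v)\<^sup>2 \<le> Im (cinner v ((ampl b - ?s) v))" for v
    using im[of v] by (simp add: blinfun.diff_left cinner_diff_right)
  from imaginary_bound_invertible[OF _ \<open>e > 0\<close> this] b semicirc_carrier
  obtain r where r: "r \<in> carrier B_ell2" "(ampl b - ?s) o\<^sub>L r = id_blinfun" "r o\<^sub>L (ampl b - ?s) = id_blinfun"
    by (metis ampl_carrier carrier_closed(4))
  have "opvalued_cauchy B_ell2 ampl corner ?s b = corner r"
    unfolding opvalued_cauchy_def using r b semicirc_carrier by (simp add: B_ell2_inv_eq)
  with r that show thesis by blast
qed

text \<open>Write S = \<open>even_embed\<close>, T = \<open>odd_embed\<close>, G =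
  \<open>corner r\<close> and y = r S v, so that S* y = G v. The even row of the equation for y
  involves the next block S* T* y; the odd row shows that T* y solves the same equation with
  right-hand side S V* S* y. Hence S* T* y = G V* G v, and inserting this into the even row is the
  claim.\<close>

lemma semicirc_functional_equation:
  assumes r: "(ampl b - semicirc D V) o\<^sub>L r = id_blinfun" "r o\<^sub>L (ampl b - semicirc D V) = id_blinfun"
  shows "b o\<^sub>L corner r = id_blinfun + ((D + (V o\<^sub>L corner r o\<^sub>L adjoint_op V)) o\<^sub>L corner r)"
proof (rule blinfun_eqI)
  fix v
  let ?a = "ampl b - semicirc D V"
  have ar: "?a (r x) = x" and ra: "r (?a x) = x" for x
    using arg_cong[OF r(1), of "\<lambda>f. f x"] arg_cong[OF r(2), of "\<lambda>f. f x"] by auto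
  define y where "y = r (even_embed v)"
  have y: "?a y = even_embed v" by (simp add: y_def ar)
  have e: "b (even_part y) = v + (D (even_part y) + V (even_part (odd_part y)))"
    using arg_cong[OF y, of "blinfun_apply even_part"]
    by (simp add: semicirc_def blinfun.bilinear_simps diff_eq_eq)
  have y': "y = even_embed (even_part y) + odd_embed (odd_part y)"
    by (simp only: even_odd_decomp)
  have "ampl b (odd_part y) = ampl D (odd_part y) + ampl V (odd_part (odd_part y)) + ampl (adjoint_op V) y"
    using arg_cong[OF y, of "blinfun_apply odd_part"]
    by (simp add: semicirc_def blinfun.bilinear_simps)
  \<comment> \<open>Compared with the odd row, \<open>semicirc\<close> at \<open>odd_part y\<close>
    has \<open>odd_embed (ampl (adjoint_op V) (odd_part y))\<close> where the row has
    \<open>ampl (adjoint_op V) y\<close>. The two differ only in the first block.\<close>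
  then have "?a (odd_part y) = ampl (adjoint_op V) y - odd_embed (ampl (adjoint_op V) (odd_part y))"
    by (simp add: semicirc_def blinfun.bilinear_simps)
  also have "\<dots> = even_embed (adjoint_op V (even_part y))"
    by (subst y') (simp add: blinfun.bilinear_simps)
  finally have "odd_part y = r (even_embed (adjoint_op V (even_part y)))"
    using ra by metis
  note e[unfolded this]
  then show "(b o\<^sub>L corner r) v
      = (id_blinfun + ((D + (V o\<^sub>L corner r o\<^sub>L adjoint_op V)) o\<^sub>L corner r)) v"
    by (simp add: blinfun.bilinear_simps y_def[symmetric])
qed

lemma semicircular_semicirc:
  "semicircular B_ell2 B_ell2 ampl corner (semicirc D V) D
     (\<lambda>a. V \<otimes>\<^bsub>B_ell2\<^esub> a \<otimes>\<^bsub>B_ell2\<^esub> adjoint_op V)"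
  unfolding semicircular_def
proof (intro conjI)
  show "is_R_transform B_ell2 B_ell2 ampl corner (semicirc D V)
      (\<lambda>b. D \<oplus>\<^bsub>B_ell2\<^esub> (V \<otimes>\<^bsub>B_ell2\<^esub> b \<otimes>\<^bsub>B_ell2\<^esub> adjoint_op V))"
    unfolding is_R_transform_def
  proof (intro ballI)
    fix b assume "b \<in> upper_half_plane B_ell2"
    then obtain e x where b: "b \<in> carrier B_ell2" and e: "e > 0" and x: "x \<in> carrier B_ell2"
      and im: "(scaleC_op (1 / (2 * \<i>)) o\<^sub>L (b - adjoint_op b)) - (scaleC_op (complex_of_real e) o\<^sub>L id_blinfun)
        = adjoint_op x o\<^sub>L x"
      by (auto simp: upper_half_plane_def cstar_positive_def cstar_Im_def carrier_closed)
    \<comment> \<open>Since \<open>ampl\<close> is a unital *-homomorphism, the witness of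
      positivity for Im b - e is carried to one for \<open>ampl b\<close>, with the same
      \<open>e\<close>.\<close>
    from im have "ampl ((scaleC_op (1 / (2 * \<i>)) o\<^sub>L (b - adjoint_op b)) - (scaleC_op (complex_of_real e) o\<^sub>L id_blinfun))
        = ampl (adjoint_op x o\<^sub>L x)" by simp
    then have im': "(scaleC_op (1 / (2 * \<i>)) o\<^sub>L (ampl b - adjoint_op (ampl b))) - (scaleC_op (complex_of_real e) o\<^sub>L id_blinfun)
        = adjoint_op (ampl x) o\<^sub>L ampl x"
      using b x by (simp add: ampl_diff ampl_compose ampl_scaleC_op ampl_id ampl_adjoint)
    have "e * (norm v)\<^sup>2 \<le> Im (cinner v (ampl b v))" for v
    proof -
      have "cinner v ((adjoint_op (ampl x) o\<^sub>L ampl x) v) = complex_of_real ((norm (ampl x v))\<^sup>2)"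
        using x by (simp add: cinner_adjoint_right cinner_self)
      then have "1 / (2 * \<i>) * (cinner v (ampl b v) - cnj (cinner v (ampl b v))) - complex_of_real e * complex_of_real ((norm v)\<^sup>2)
          = complex_of_real ((norm (ampl x v))\<^sup>2)"
        using b unfolding im'[symmetric]
        by (simp add: blinfun.bilinear_simps cinner_diff_right cinner_scaleC_right cinner_scaleR_right
            cinner_adjoint_right cinner_self cinner_commute[of "ampl b v" v]
            right_diff_distrib diff_divide_distrib)
      then have "Im (cinner v (ampl b v)) - e * (norm v)\<^sup>2 = (norm (ampl x v))\<^sup>2"
        by (simp add: complex_eq_iff complex_diff_cnj)
      then show ?thesis using zero_le_power2[of "norm (ampl x v)"] by linarith
    qed
    from semicirc_resolvent[OF b e this] obtain r where
      "(ampl b - semicirc D V) o\<^sub>L r = id_blinfun" "r o\<^sub>L (ampl b - semicirc D V) = id_blinfun"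
      "opvalued_cauchy B_ell2 ampl corner (semicirc D V) b = corner r" by metis
    with semicirc_functional_equation[of b r] show "let g = opvalued_cauchy B_ell2 ampl corner (semicirc D V) b in
        b \<otimes>\<^bsub>B_ell2\<^esub> g = \<one>\<^bsub>B_ell2\<^esub> \<oplus>\<^bsub>B_ell2\<^esub>
          (D \<oplus>\<^bsub>B_ell2\<^esub> (V \<otimes>\<^bsub>B_ell2\<^esub> g \<otimes>\<^bsub>B_ell2\<^esub> adjoint_op V)) \<otimes>\<^bsub>B_ell2\<^esub> g"
      by (simp add: Let_def)
  qed
qed (use D V in \<open>simp_all add: semicirc_carrier semicirc_selfadjoint DD completely_positive_compose[simplified]\<close>)

end

section \<open>Orthogonal polynomials and bounds on the Jacobi coefficients\<close>

text \<open>The complement of the support is a union of open null sets, and the Lindelof property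
  makes it a countable one.\<close>

lemma (in real_distribution) AE_msupport: "AE t in M. t \<in> msupport M"
proof -
  define F where "F = {U. open U \<and> emeasure M U = 0}"
  obtain F' where F': "F' \<subseteq> F" "countable F'" "\<Union>F' = \<Union>F"
    using Lindelof[of F] unfolding F_def by blast
  have "(\<Union>U\<in>F'. U) \<in> null_sets M"
    using F' by (intro null_sets_UN') (auto simp: F_def null_sets_def)
  then have "AE t in M. t \<notin> \<Union>F'" by (auto dest: AE_not_in)
  moreover have "t \<in> msupport M" if "t \<notin> \<Union>F" for t
    using that unfolding msupport_def F_def by (auto simp: zero_less_iff_neq_zero)
  ultimately show ?thesis using F'(3) by auto
qed

lemma (in real_distribution) msupport_subset:
  assumes "closed F" "AE t in M. t \<in> F"
  shows "msupport M \<subseteq> F"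
proof
  fix x assume x: "x \<in> msupport M"
  show "x \<in> F"
  proof (rule ccontr)
    assume "x \<notin> F"
    with x assms(1) have "emeasure M (- F) > 0" unfolding msupport_def by auto
    moreover have "emeasure M (- F) = 0"
      using assms AE_iff_null_sets[of "- F" M] by (auto simp: null_sets_def)
    ultimately show False by simp
  qed
qed

lemma (in real_distribution) msupport_nonempty: "msupport M \<noteq> {}"
proof
  assume "msupport M = {}"
  then have "AE t in M. False" using AE_msupport by simp
  then show False by simp
qed

lemma borel_measurable_poly [measurable]: "(\<lambda>t::real. poly p t) \<in> borel_measurable borel"
  by (intro borel_measurable_continuous_onI continuous_intros)

text \<open>The coefficient condition says that \<open>b n\<close> is monic of degree n, so
  subtracting multiples of the \<open>b n\<close> from the top removes one degree at a time. It
  gives orthogonality to lower degrees and uniqueness of the moment functional.\<close>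

lemma poly_monic_basis_induct:
  fixes b :: "nat \<Rightarrow> 'a :: comm_ring_1 poly"
  assumes b: "\<And>n k. n \<le> k \<Longrightarrow> coeff (b n) k = of_bool (k = n)"
    and q: "\<And>k. N \<le> k \<Longrightarrow> coeff q k = 0"
    and P0: "P 0"
    and step: "\<And>c n r. n < N \<Longrightarrow> P r \<Longrightarrow> P (Polynomial.smult c (b n) + r)"
  shows "P q"
proof -
  have "n \<le> N \<Longrightarrow> (\<And>k. n \<le> k \<Longrightarrow> coeff q k = 0) \<Longrightarrow> P q" for n q
  proof (induction n arbitrary: q)
    case 0
    then have "q = 0" by (intro poly_eqI) simp
    with P0 show ?case by simp
  next
    case (Suc n)
    define r where "r = q - Polynomial.smult (coeff q n) (b n)"
    have "coeff r k = 0" if "n \<le> k" for k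
      using Suc.prems that b[OF that] by (cases "k = n") (auto simp: r_def)
    then have "P r" using Suc by simp
    then have "P (Polynomial.smult (coeff q n) (b n) + r)" using Suc.prems by (intro step) simp_all
    then show ?case by (simp add: r_def)
  qed
  from this[of N q] q show ?thesis by simp
qed

section \<open>Orthogonality and degeneration of the monic polynomials\<close>

locale compact_real_distribution = real_distribution \<mu> for \<mu> :: "real measure" +
  assumes compact_support: "compactly_supported \<mu>"
begin

definition radius :: real where
  "radius = (SOME M. M > 0 \<and> (\<forall>t\<in>msupport \<mu>. \<bar>t\<bar> \<le> M))"

lemma radius: "radius > 0" "t \<in> msupport \<mu> \<Longrightarrow> \<bar>t\<bar> \<le> radius"
proof -
  have "\<exists>M. M > 0 \<and> (\<forall>t\<in>msupport \<mu>. \<bar>t\<bar> \<le> M)"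
    using compact_imp_bounded[OF compact_support[unfolded compactly_supported_def]]
    unfolding bounded_pos by (auto simp: real_norm_def)
  from someI_ex[OF this]
  show "radius > 0" "t \<in> msupport \<mu> \<Longrightarrow> \<bar>t\<bar> \<le> radius" by (auto simp: radius_def)
qed

lemma AE_radius: "AE t in \<mu>. \<bar>t\<bar> \<le> radius"
  using AE_msupport by (rule AE_mp) (auto intro: radius)

lemma integrable_bounded_on_support:
  fixes f :: "real \<Rightarrow> 'b :: {banach, second_countable_topology}"
  assumes "f \<in> borel_measurable borel" "\<And>t. \<bar>t\<bar> \<le> radius \<Longrightarrow> norm (f t) \<le> C"
  shows "integrable \<mu> f"
proof (rule integrable_const_bound[of f C])
  show "AE t in \<mu>. norm (f t) \<le> C" using AE_radius by (rule AE_mp) (use assms in auto)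
qed (use assms in simp)

lemma integrable_poly [intro, simp]: "integrable \<mu> (\<lambda>t. poly p t)"
proof -
  have "compact ((\<lambda>t. poly p t) ` {-radius..radius})"
    by (intro compact_continuous_image continuous_intros compact_Icc)
  then have "bounded ((\<lambda>t. poly p t) ` {-radius..radius})" by (rule compact_imp_bounded)
  then obtain C where "\<forall>t\<in>{-radius..radius}. norm (poly p t) \<le> C"
    by (auto simp: bounded_iff)
  then show ?thesis by (intro integrable_bounded_on_support[of _ C]) (auto simp: abs_le_iff)
qed

lemma L2_inner_eq: "L2_inner \<mu> p q = (\<integral>t. poly (p * q) t \<partial>\<mu>)"
  by (simp add: L2_inner_def)

lemma L2_inner_commute: "L2_inner \<mu> p q = L2_inner \<mu> q p"
  by (simp add: L2_inner_eq mult.commute)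

lemma integral_poly_linear:
  "(\<integral>t. poly (p + q) t \<partial>\<mu>) = (\<integral>t. poly p t \<partial>\<mu>) + (\<integral>t. poly q t \<partial>\<mu>)"
  "(\<integral>t. poly (p - q) t \<partial>\<mu>) = (\<integral>t. poly p t \<partial>\<mu>) - (\<integral>t. poly q t \<partial>\<mu>)"
  "(\<integral>t. poly (Polynomial.smult c p) t \<partial>\<mu>) = c * (\<integral>t. poly p t \<partial>\<mu>)"
  by (simp_all add: Bochner_Integration.integral_add Bochner_Integration.integral_diff)

lemma L2_inner_linear:
  "L2_inner \<mu> (p + p') q = L2_inner \<mu> p q + L2_inner \<mu> p' q"
  "L2_inner \<mu> (p - p') q = L2_inner \<mu> p q - L2_inner \<mu> p' q"
  "L2_inner \<mu> (Polynomial.smult c p) q = c * L2_inner \<mu> p q"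
  "L2_inner \<mu> 0 q = 0"
  by (simp_all only: L2_inner_eq distrib_right left_diff_distrib mult_smult_left integral_poly_linear) simp

lemma L2_inner_linear_right:
  "L2_inner \<mu> q (p + p') = L2_inner \<mu> q p + L2_inner \<mu> q p'"
  "L2_inner \<mu> q (p - p') = L2_inner \<mu> q p - L2_inner \<mu> q p'"
  "L2_inner \<mu> q (Polynomial.smult c p) = c * L2_inner \<mu> q p"
  "L2_inner \<mu> q 0 = 0"
  by (simp_all only: L2_inner_commute[of q] L2_inner_linear)

lemma L2_inner_sum: "L2_inner \<mu> (sum f I) q = (\<Sum>i\<in>I. L2_inner \<mu> (f i) q)"
  by (induction I rule: infinite_finite_induct) (simp_all add: L2_inner_linear)

lemma L2_inner_self_nonneg: "0 \<le> L2_inner \<mu> p p"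
  by (simp add: L2_inner_def)

lemma L2_inner_self_eq_0: "L2_inner \<mu> p p = 0 \<Longrightarrow> AE t in \<mu>. poly p t = 0"
  using integral_nonneg_eq_0_iff_AE[of \<mu> "\<lambda>t. poly p t * poly p t"] integrable_poly[of "p * p"]
  by (simp add: L2_inner_def)

lemma integral_poly_AE_zero:
  assumes "AE t in \<mu>. poly p t = 0"
  shows "(\<integral>t. poly (p * q) t \<partial>\<mu>) = 0"
proof -
  have "AE t in \<mu>. poly (p * q) t = 0" using assms by (rule AE_mp) simp
  then show ?thesis by (rule integral_eq_zero_AE)
qed

lemma coeff_monic_OP: "m \<le> k \<Longrightarrow> coeff (monic_OP \<mu> m) k = of_bool (k = m)"
proof (induction m arbitrary: k rule: less_induct)
  case (less m)
  then show ?case by (subst monic_OP.simps) (auto simp: coeff_sum intro!: sum.neutral)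
qed

lemma monic_OP_0: "monic_OP \<mu> 0 = 1"
  by (subst monic_OP.simps) simp

lemma monic_OP_orthogonal: "j < m \<Longrightarrow> L2_inner \<mu> (monic_OP \<mu> m) (monic_OP \<mu> j) = 0"
proof (induction m arbitrary: j rule: less_induct)
  case (less m)
  let ?p = "monic_OP \<mu>"
  let ?c = "\<lambda>i. L2_inner \<mu> (monom 1 m) (?p i) / L2_inner \<mu> (?p i) (?p i)"
  have "L2_inner \<mu> (?p i) (?p j) = 0" if "i < m" "i \<noteq> j" for i
    using that less.IH[of i j] less.IH[of j i] less.prems L2_inner_commute[of "?p i" "?p j"]
    by (cases i j rule: linorder_cases) auto
  then have "(\<Sum>i<m. ?c i * L2_inner \<mu> (?p i) (?p j)) = ?c j * L2_inner \<mu> (?p j) (?p j)"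
    using less.prems by (subst sum.remove[of _ j]) auto
  moreover have "?c j * L2_inner \<mu> (?p j) (?p j) = L2_inner \<mu> (monom 1 m) (?p j)"
  \<comment> \<open>A vanishing denominator makes the Gram-Schmidt quotient 0. The identity survives
    because \<open>?p j\<close> is then zero almost everywhere, so the numerator vanishes
    too.\<close>
  proof (cases "L2_inner \<mu> (?p j) (?p j) = 0")
    case True
    then have "L2_inner \<mu> (monom 1 m) (?p j) = 0"
      using integral_poly_AE_zero[OF L2_inner_self_eq_0] by (simp add: L2_inner_eq mult.commute)
    with True show ?thesis by simp
  qed simp
  ultimately show ?case
    by (subst monic_OP.simps) (simp add: L2_inner_linear L2_inner_sum)
qed

lemma monic_OP_orthogonal_lower:
  assumes "\<And>k. m \<le> k \<Longrightarrow> coeff q k = 0"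
  shows "L2_inner \<mu> (monic_OP \<mu> m) q = 0"
  by (rule poly_monic_basis_induct[where b = "monic_OP \<mu>" and N = m])
    (simp_all add: coeff_monic_OP assms L2_inner_linear_right monic_OP_orthogonal)

text \<open>The indices \<open>m\<close> for which \<open>monic_OP \<mu> m\<close> does not vanish in $L^2(\mu)$.\<close>

definition proper_index :: "nat \<Rightarrow> bool" where
  "proper_index m \<longleftrightarrow> (finite (msupport \<mu>) \<longrightarrow> m < card (msupport \<mu>))"

lemma proper_index_mono: "proper_index m \<Longrightarrow> n \<le> m \<Longrightarrow> proper_index n"
  by (auto simp: proper_index_def)

text \<open>If the norm were zero, the support would lie in the root set of a nonzero polynomial of
  degree at most m.\<close>

lemma monic_OP_norm_pos:
  assumes "proper_index m"
  shows "L2_inner \<mu> (monic_OP \<mu> m) (monic_OP \<mu> m) > 0"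
proof (rule ccontr)
  assume "\<not> ?thesis"
  then have 0: "AE t in \<mu>. poly (monic_OP \<mu> m) t = 0"
    using L2_inner_self_nonneg[of "monic_OP \<mu> m"] by (intro L2_inner_self_eq_0) simp
  have nz: "monic_OP \<mu> m \<noteq> 0" using coeff_monic_OP[of m m] by auto
  let ?Z = "{t. poly (monic_OP \<mu> m) t = 0}"
  have fin: "finite ?Z" using nz by (rule poly_roots_finite)
  have sub: "msupport \<mu> \<subseteq> ?Z" using fin 0 by (intro msupport_subset finite_imp_closed) auto
  then have "card (msupport \<mu>) \<le> card ?Z" using fin by (intro card_mono)
  also have "\<dots> \<le> degree (monic_OP \<mu> m)" using nz by (rule card_poly_roots_bound)
  also have "\<dots> \<le> m" using coeff_monic_OP[of m] by (intro degree_le) auto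
  finally show False using assms finite_subset[OF sub fin] by (simp add: proper_index_def)
qed

text \<open>Compare with the monic polynomial vanishing exactly on the support. The difference has
  lower degree, hence is orthogonal to \<open>?p\<close>, and the comparison polynomial is zero
  almost everywhere; so \<open>?p\<close> is orthogonal to itself.\<close>

lemma monic_OP_card_zero:
  assumes "finite (msupport \<mu>)"
  shows "AE t in \<mu>. poly (monic_OP \<mu> (card (msupport \<mu>))) t = 0"
proof -
  let ?S = "msupport \<mu>"
  let ?p = "monic_OP \<mu> (card ?S)"
  define \<pi> where "\<pi> = (\<Prod>x\<in>?S. [:-x, 1:])"
  have deg: "degree \<pi> = card ?S"
    unfolding \<pi>_def by (subst degree_prod_eq_sum_degree) auto
  have lc: "lead_coeff \<pi> = 1"
    unfolding \<pi>_def by (simp add: lead_coeff_prod)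
  have "coeff (?p - \<pi>) k = 0" if "card ?S \<le> k" for k
    using that lc deg coeff_monic_OP[of "card ?S" k] by (cases "k = card ?S") (auto simp: coeff_eq_0)
  then have "L2_inner \<mu> ?p (?p - \<pi>) = 0" by (rule monic_OP_orthogonal_lower)
  moreover have "L2_inner \<mu> \<pi> ?p = 0"
  proof -
    have "AE t in \<mu>. poly \<pi> t = 0"
      using AE_msupport by (rule AE_mp) (use assms in \<open>auto simp: \<pi>_def poly_prod\<close>)
    then show ?thesis unfolding L2_inner_eq by (rule integral_poly_AE_zero)
  qed
  ultimately have "L2_inner \<mu> ?p ?p = 0"
    by (simp add: L2_inner_commute[of \<pi>] L2_inner_linear_right)
  then show ?thesis by (rule L2_inner_self_eq_0)
qed

end

section \<open>Bounds on the Jacobi coefficients and uniqueness of the moments\<close>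

locale jacobi = compact_real_distribution +
  fixes \<omega> \<alpha> :: "nat \<Rightarrow> real"
  assumes jacobi: "jacobi_coefficients \<mu> \<omega> \<alpha>"
begin

lemma monic_OP_recurrence:
  assumes "proper_index m"
  shows "[:0, 1:] * monic_OP \<mu> m = monic_OP \<mu> (Suc m) + Polynomial.smult (\<alpha> (Suc m)) (monic_OP \<mu> m)
    + (if m = 0 then 0 else Polynomial.smult (\<omega> m) (monic_OP \<mu> (m - 1)))"
proof (cases "m = 0")
  case True
  have "monic_OP \<mu> 1 = [:- \<alpha> 1, 1:]" using jacobi by (simp add: jacobi_coefficients_def)
  with True show ?thesis by (simp add: monic_OP_0)
next
  case False
  then show ?thesis using jacobi assms by (simp add: jacobi_coefficients_def proper_index_def)
qed

lemma improper_zero: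
  "\<not> proper_index m \<Longrightarrow> \<omega> m = 0" "\<not> proper_index m \<Longrightarrow> \<alpha> (Suc m) = 0"
  using jacobi by (auto simp: jacobi_coefficients_def proper_index_def)

lemma omega_nonneg: "m > 0 \<Longrightarrow> 0 \<le> \<omega> m"
  using jacobi improper_zero(1)[of m]
  by (cases "proper_index m") (auto simp: jacobi_coefficients_def proper_index_def intro: less_imp_le)

lemma L2_inner_mult_x: "L2_inner \<mu> ([:0, 1:] * p) q = L2_inner \<mu> p ([:0, 1:] * q)"
  by (simp add: L2_inner_eq mult.left_commute)

text \<open>For a proper index the coefficient is the Rayleigh quotient of multiplication by t at
  \<open>monic_OP \<mu> m\<close>, and t is bounded by \<open>radius\<close> almost
  everywhere.\<close>

lemma abs_alpha_le: "\<bar>\<alpha> (Suc m)\<bar> \<le> radius"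
proof (cases "proper_index m")
  case True
  let ?p = "monic_OP \<mu>"
  let ?h = "L2_inner \<mu> (?p m) (?p m)"
  have h: "?h > 0" using True by (rule monic_OP_norm_pos)
  have "L2_inner \<mu> ([:0, 1:] * ?p m) (?p m) = \<alpha> (Suc m) * ?h"
    unfolding monic_OP_recurrence[OF True]
    by (auto simp: L2_inner_linear monic_OP_orthogonal L2_inner_commute[of "?p (m - Suc 0)" "?p m"])
  then have "\<bar>\<alpha> (Suc m)\<bar> * ?h = \<bar>\<integral>t. poly ([:0, 1:] * ?p m * ?p m) t \<partial>\<mu>\<bar>"
    using h unfolding L2_inner_eq by (metis abs_mult abs_of_pos)
  also have "\<dots> \<le> (\<integral>t. \<bar>poly ([:0, 1:] * ?p m * ?p m) t\<bar> \<partial>\<mu>)" by (rule integral_abs_bound)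
  also have "\<dots> \<le> (\<integral>t. poly (Polynomial.smult radius (?p m * ?p m)) t \<partial>\<mu>)"
  proof (rule integral_mono_AE)
    have "\<bar>poly ([:0, 1:] * ?p m * ?p m) t\<bar> \<le> poly (Polynomial.smult radius (?p m * ?p m)) t"
      if "\<bar>t\<bar> \<le> radius" for t
    proof -
      have "\<bar>t\<bar> * (poly (?p m) t)\<^sup>2 \<le> radius * (poly (?p m) t)\<^sup>2"
        using that by (intro mult_right_mono) auto
      then show ?thesis by (simp add: power2_eq_square mult.assoc abs_mult)
    qed
    then show "AE t in \<mu>. \<bar>poly ([:0, 1:] * ?p m * ?p m) t\<bar> \<le> poly (Polynomial.smult radius (?p m * ?p m)) t"
      using AE_radius by (auto intro: AE_mp)
  qed (intro integrable_abs integrable_poly)+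
  also have "\<dots> = radius * ?h" by (simp only: integral_poly_linear L2_inner_eq)
  finally show ?thesis using h by simp
next
  case False
  then show ?thesis using radius(1) by (simp add: improper_zero)
qed

text \<open>The coefficient is the ratio of the squared norms of p_{m+1} and p_m. Since t p_m -
  p_{m+1} has degree at most m, it is orthogonal to p_{m+1}; so the norm of p_{m+1} is at most that
  of t p_m.\<close>

lemma omega_le: "\<omega> (Suc m) \<le> radius\<^sup>2"
proof (cases "proper_index (Suc m)")
  case True
  let ?p = "monic_OP \<mu>"
  let ?h = "\<lambda>m. L2_inner \<mu> (?p m) (?p m)"
  have h: "?h m > 0" using proper_index_mono[OF True] by (intro monic_OP_norm_pos) simp
  define r where "r = [:0, 1:] * ?p m - ?p (Suc m)"
  have r: "[:0, 1:] * ?p m = ?p (Suc m) + r" by (simp add: r_def)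
  have "coeff r k = 0" if "Suc m \<le> k" for k
    using that coeff_monic_OP[of "Suc m" k] coeff_monic_OP[of m "k - 1"]
    by (cases k) (auto simp: r_def coeff_pCons)
  then have orth: "L2_inner \<mu> (?p (Suc m)) r = 0" by (rule monic_OP_orthogonal_lower)
  have "L2_inner \<mu> ([:0, 1:] * ?p (Suc m)) (?p m) = \<omega> (Suc m) * ?h m"
    unfolding monic_OP_recurrence[OF True] by (simp add: L2_inner_linear monic_OP_orthogonal)
  moreover have "L2_inner \<mu> ([:0, 1:] * ?p (Suc m)) (?p m) = ?h (Suc m)"
    unfolding L2_inner_mult_x r
    by (simp add: L2_inner_linear_right orth)
  ultimately have "\<omega> (Suc m) * ?h m = ?h (Suc m)" by simp
  also have "\<dots> \<le> ?h (Suc m) + L2_inner \<mu> r r" using L2_inner_self_nonneg by simp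
  also have "\<dots> = L2_inner \<mu> ([:0, 1:] * ?p m) ([:0, 1:] * ?p m)"
    unfolding r
    by (simp add: L2_inner_linear L2_inner_linear_right orth L2_inner_commute[of r "?p (Suc m)"])
  also have "\<dots> \<le> (\<integral>t. poly (Polynomial.smult (radius\<^sup>2) (?p m * ?p m)) t \<partial>\<mu>)"
    unfolding L2_inner_eq
  proof (rule integral_mono_AE)
    have "poly ([:0, 1:] * ?p m * ([:0, 1:] * ?p m)) t \<le> poly (Polynomial.smult (radius\<^sup>2) (?p m * ?p m)) t"
      if "\<bar>t\<bar> \<le> radius" for t
    proof -
      have "t\<^sup>2 * (poly (?p m) t)\<^sup>2 \<le> radius\<^sup>2 * (poly (?p m) t)\<^sup>2"
        using that by (intro mult_right_mono) (auto simp: abs_le_square_iff[symmetric])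
      then show ?thesis by (simp add: power2_eq_square mult_ac)
    qed
    then show "AE t in \<mu>. poly ([:0, 1:] * ?p m * ([:0, 1:] * ?p m)) t \<le> poly (Polynomial.smult (radius\<^sup>2) (?p m * ?p m)) t"
      using AE_radius by (auto intro: AE_mp)
  qed (intro integrable_abs integrable_poly)+
  also have "\<dots> = radius\<^sup>2 * ?h m" by (simp only: integral_poly_linear L2_inner_eq)
  finally show ?thesis using h by simp
next
  case False
  then show ?thesis by (simp add: improper_zero)
qed

text \<open>For finite support only finitely many p_n are nonzero in L^2. Multiples of the first
  vanishing one complete them to a monic basis, and the integral is zero on those multiples, so
  \<open>L\<close> has to be zero there as well.\<close>

lemma integral_poly_unique:
  fixes L :: "real poly \<Rightarrow> complex"
  assumes linear: "\<And>p q. L (p + q) = L p + L q" "\<And>c p. L (Polynomial.smult c p) = complex_of_real c * L p"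
    and one: "L 1 = 1"
    and proper: "\<And>m. proper_index (Suc m) \<Longrightarrow> L (monic_OP \<mu> (Suc m)) = 0"
    and improper: "\<And>k. finite (msupport \<mu>) \<Longrightarrow> L (monic_OP \<mu> (card (msupport \<mu>)) * monom 1 k) = 0"
  shows "L q = complex_of_real (\<integral>t. poly q t \<partial>\<mu>)"
proof -
  define b where "b n = (if proper_index n then monic_OP \<mu> n
      else monic_OP \<mu> (card (msupport \<mu>)) * monom 1 (n - card (msupport \<mu>)))" for n
  have b: "coeff (b n) k = of_bool (k = n)" if "n \<le> k" for n k
  proof (cases "proper_index n")
    case False
    then have n: "card (msupport \<mu>) \<le> n" by (auto simp: proper_index_def)
    with False that show ?thesis
      using coeff_monic_OP[of "card (msupport \<mu>)" "k - (n - card (msupport \<mu>))"]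
      by (auto simp: b_def coeff_monom_mult mult.commute[of _ "monom _ _"])
  qed (use that in \<open>simp add: b_def coeff_monic_OP\<close>)
  have eq: "L (b n) = complex_of_real (\<integral>t. poly (b n) t \<partial>\<mu>)" for n
  proof (cases "proper_index n")
    case True
    show ?thesis
    proof (cases n)
      case 0
      then show ?thesis using True one prob_space by (simp add: b_def monic_OP_0)
    next
      case (Suc m)
      have "(\<integral>t. poly (monic_OP \<mu> n) t \<partial>\<mu>) = 0"
        using monic_OP_orthogonal[of 0 n] Suc by (simp add: L2_inner_eq monic_OP_0)
      with Suc True proper show ?thesis by (simp add: b_def)
    qed
  next
    case False
    then have "finite (msupport \<mu>)" by (simp add: proper_index_def)
    then show ?thesis
      using False improper integral_poly_AE_zero[OF monic_OP_card_zero] by (simp add: b_def del: poly_mult)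
  qed
  have L0: "L 0 = 0" using linear(2)[of 0 0] by simp
  have "coeff q k = 0" if "Suc (degree q) \<le> k" for k using that by (intro coeff_eq_0) simp
  from b this show ?thesis
    by (rule poly_monic_basis_induct[where b = b and N = "Suc (degree q)"])
      (simp_all only: linear integral_poly_linear eq of_real_add of_real_mult, simp add: L0)
qed

end

section \<open>Moments and the resolvent\<close>

lemma diagonal_operator_exists:
  fixes f :: "nat \<Rightarrow> real"
  assumes f: "\<And>n. \<bar>f n\<bar> \<le> C"
  obtains D where "D \<in> carrier B_ell2" "\<And>x n. coord (D x) n = complex_of_real (f n) * coord x n"
proof -
  have C: "C \<ge> 0" using f[of 0] by simp
  have "\<exists>y. coord y = (\<lambda>n. complex_of_real (f n) * coord x n) \<and> norm y \<le> C * norm x" for x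
  proof -
    have "(\<Sum>n<N. (cmod (complex_of_real (f n) * coord x n))\<^sup>2) \<le> (C * norm x)\<^sup>2" for N
    proof -
      have "(\<Sum>n<N. (cmod (complex_of_real (f n) * coord x n))\<^sup>2) \<le> (\<Sum>n<N. C\<^sup>2 * (cmod (coord x n))\<^sup>2)"
      proof (rule sum_mono)
        fix n
        have "(f n)\<^sup>2 \<le> C\<^sup>2" using f[of n] C by (simp add: abs_le_square_iff[symmetric])
        then show "(cmod (complex_of_real (f n) * coord x n))\<^sup>2 \<le> C\<^sup>2 * (cmod (coord x n))\<^sup>2"
          by (simp add: norm_mult power_mult_distrib mult_right_mono)
      qed
      also have "\<dots> \<le> C\<^sup>2 * (norm x)\<^sup>2"
        unfolding sum_distrib_left[symmetric] by (intro mult_left_mono sum_coord_le) auto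
      finally show ?thesis by (simp add: power_mult_distrib)
    qed
    then obtain y where "coord y = (\<lambda>n. complex_of_real (f n) * coord x n)" "(norm y)\<^sup>2 \<le> (C * norm x)\<^sup>2"
      by (rule square_summable_ell2I)
    moreover from this(2) have "norm y \<le> C * norm x" by (rule power2_le_imp_le) (use C in simp)
    ultimately show ?thesis by blast
  qed
  then obtain h where h: "\<And>x. coord (h x) = (\<lambda>n. complex_of_real (f n) * coord x n)"
    "\<And>x. norm (h x) \<le> C * norm x" by metis
  have "bounded_linear h"
    by (rule bounded_linear_intro[where K = C])
      (auto intro!: ell2_eqI simp: h(1) algebra_simps, simp add: h(2) mult.commute)
  then have B: "blinfun_apply (Blinfun h) = h" by (rule bounded_linear_Blinfun_apply)
  show thesis
  proof (rule that[of "Blinfun h"])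
    show "Blinfun h \<in> carrier B_ell2"
      unfolding carrier_B_ell2 B by (auto intro!: ell2_eqI simp: h(1))
  qed (simp add: B h(1))
qed

lemma Weierstrass_real_poly:
  fixes f :: "real \<Rightarrow> real"
  assumes "continuous_on {a..b} f" "e > 0"
  shows "\<exists>p. \<forall>t\<in>{a..b}. \<bar>f t - poly p t\<bar> < e"
proof -
  obtain g where g: "real_polynomial_function g" "\<And>t. t \<in> {a..b} \<Longrightarrow> \<bar>f t - g t\<bar> < e"
    using Stone_Weierstrass_real_polynomial_function[OF compact_Icc assms] by blast
  then obtain c n where "g = (\<lambda>x. \<Sum>i\<le>n. c i * x ^ i)"
    unfolding real_polynomial_function_iff_sum by blast
  then have "poly (\<Sum>i\<le>n. monom (c i) i) = g"
    by (simp add: fun_eq_iff poly_sum poly_monom)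
  with g show ?thesis by metis
qed

text \<open>This is the vector p(s) d, evaluated by Horner's scheme.\<close>

definition poly_orbit :: "(ell2 \<Rightarrow>\<^sub>L ell2) \<Rightarrow> ell2 \<Rightarrow> real poly \<Rightarrow> ell2" where
  "poly_orbit s d p = fold_coeffs (\<lambda>a v. a *\<^sub>R d + s v) p 0"

lemma poly_orbit_pCons: "poly_orbit s d (pCons a p) = a *\<^sub>R d + s (poly_orbit s d p)"
  by (cases "p = 0 \<and> a = 0") (auto simp: poly_orbit_def blinfun.zero_right)

lemma poly_orbit_0 [simp]: "poly_orbit s d 0 = 0"
  by (simp add: poly_orbit_def)

lemma poly_orbit_1 [simp]: "poly_orbit s d 1 = d"
  unfolding one_pCons by (simp add: poly_orbit_pCons blinfun.zero_right)

lemma poly_orbit_add: "poly_orbit s d (p + q) = poly_orbit s d p + poly_orbit s d q"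
  by (induction p q rule: poly_induct2)
    (simp_all add: poly_orbit_pCons blinfun.add_right scaleR_add_left)

lemma poly_orbit_smult: "poly_orbit s d (Polynomial.smult c p) = c *\<^sub>R poly_orbit s d p"
  by (induction p) (simp_all add: poly_orbit_pCons blinfun.scaleR_right scaleR_add_right)

lemma poly_orbit_diff: "poly_orbit s d (p - q) = poly_orbit s d p - poly_orbit s d q"
  using poly_orbit_add[of s d "p - q" q] by (simp add: algebra_simps)

lemma poly_orbit_mult_x: "poly_orbit s d ([:0, 1:] * p) = s (poly_orbit s d p)"
  by (simp add: poly_orbit_pCons)

lemma poly_orbit_mult_eq_0: "poly_orbit s d p = 0 \<Longrightarrow> poly_orbit s d (p * monom 1 k) = 0"
  by (induction k) (simp_all add: monom_Suc poly_orbit_pCons blinfun.zero_right flip: one_pCons)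

text \<open>Self-adjointness moves the factors s from the left argument to the right one by one;
  \<open>q\<close> stays arbitrary so that it can absorb each factor t.\<close>

lemma cinner_poly_orbit:
  assumes s: "s \<in> carrier B_ell2" "adjoint_op s = s"
  shows "cinner (poly_orbit s d p) (poly_orbit s d q) = cinner d (poly_orbit s d (p * q))"
proof (induction p arbitrary: q)
  case (pCons a p)
  have "cinner (s v) w = cinner v (s w)" for v w
    using cinner_adjoint_left[OF s(1)] by (simp only: s(2))
  moreover have "cinner (a *\<^sub>R v) w = cinner v (a *\<^sub>R w)" for v w
    using cinner_scaleC_left[of "complex_of_real a" v w] by (simp add: cinner_scaleR_right)
  ultimately show ?case
    using pCons.IH[of "pCons 0 q"]
    by (simp add: poly_orbit_pCons cinner_add_left cinner_add_right pCons.IH poly_orbit_add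
        poly_orbit_smult)
qed simp

context compact_real_distribution
begin

text \<open>The squared norm equals the integral of p^2, so a bound for p on the interval of radius
  \<open>radius\<close> suffices.\<close>

lemma norm_poly_orbit_le:
  assumes s: "s \<in> carrier B_ell2" "adjoint_op s = s"
    and L: "\<And>q. cinner d (poly_orbit s d q) = complex_of_real (\<integral>t. poly q t \<partial>\<mu>)"
    and C: "0 \<le> C" "\<And>t. \<bar>t\<bar> \<le> radius \<Longrightarrow> \<bar>poly p t\<bar> \<le> C"
  shows "norm (poly_orbit s d p) \<le> C"
proof -
  have "complex_of_real ((norm (poly_orbit s d p))\<^sup>2) = complex_of_real (\<integral>t. poly (p * p) t \<partial>\<mu>)"
    by (simp only: cinner_self[symmetric] cinner_poly_orbit[OF s] L)
  then have "(norm (poly_orbit s d p))\<^sup>2 = (\<integral>t. poly (p * p) t \<partial>\<mu>)" by (simp only: of_real_eq_iff)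
  also have "\<dots> \<le> (\<integral>t. C\<^sup>2 \<partial>\<mu>)"
  proof (rule integral_mono_AE)
    have "poly (p * p) t \<le> C\<^sup>2" if "\<bar>t\<bar> \<le> radius" for t
      using power_mono[OF C(2)[OF that] abs_ge_zero, of 2] by (simp add: power2_eq_square)
    then show "AE t in \<mu>. poly (p * p) t \<le> C\<^sup>2" using AE_radius by (auto intro: AE_mp)
  qed (rule integrable_poly, simp)
  also have "\<dots> = C\<^sup>2" using prob_space by simp
  finally show ?thesis by (rule power2_le_imp_le) (rule C(1))
qed

text \<open>Polynomials close to $1/(\xi - t)$ on the support give approximate solutions of
  $(\xi - s) y = d$.\<close>

lemma cauchy_transform_eq_resolvent:
  assumes s: "s \<in> carrier B_ell2" "adjoint_op s = s"
    and L: "\<And>q. cinner d (poly_orbit s d q) = complex_of_real (\<integral>t. poly q t \<partial>\<mu>)"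
    and r: "r o\<^sub>L (scaleC_op \<xi> - s) = id_blinfun" and \<xi>: "Im \<xi> > 0"
  shows "cauchy_transform \<mu> \<xi> = cinner d (r d)"
proof -
  define f where "f t = 1 / (\<xi> - complex_of_real t)" for t
  have nz: "\<xi> - complex_of_real t \<noteq> 0" for t using \<xi> by (auto simp: complex_eq_iff)
  have contf: "continuous_on A f" for A
    unfolding f_def using nz by (intro continuous_intros) auto
  \<comment> \<open>On the interval, \<xi> - t has modulus at most
    \<open>cmod \<xi> + radius\<close>; the factor 2 comes from approximating real and imaginary
    parts within e each.\<close>
  define K where "K = 2 * (cmod \<xi> + radius)"
  have K: "K \<ge> 0" using radius(1) by (simp add: K_def)
  have main: "cmod (cauchy_transform \<mu> \<xi> - cinner d (r d)) \<le> (2 + norm d * (norm r * (2 * K))) * e" if e: "e > 0" for e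
  proof -
    obtain P where P: "\<And>t. t \<in> {-radius..radius} \<Longrightarrow> \<bar>Re (f t) - poly P t\<bar> < e"
      using Weierstrass_real_poly[OF continuous_on_Re[OF contf] e, of "-radius" radius] by blast
    obtain Q where Q: "\<And>t. t \<in> {-radius..radius} \<Longrightarrow> \<bar>Im (f t) - poly Q t\<bar> < e"
      using Weierstrass_real_poly[OF continuous_on_Im[OF contf] e, of "-radius" radius] by blast
    define g where "g t = complex_of_real (poly P t) + \<i> * complex_of_real (poly Q t)" for t
    have fg: "cmod (f t - g t) \<le> 2 * e" if "\<bar>t\<bar> \<le> radius" for t
      using cmod_le[of "f t - g t"] P[of t] Q[of t] that by (auto simp: g_def abs_le_iff)
    \<comment> \<open>\<open>A\<close> and \<open>B\<close> are the real and imaginary parts of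
      (\<xi> - t) g(t) - 1, kept as real polynomials because the moment identity is stated for
      those.\<close>
    define A where "A = Polynomial.smult (Re \<xi>) P - [:0, 1:] * P - Polynomial.smult (Im \<xi>) Q - 1"
    define B where "B = Polynomial.smult (Re \<xi>) Q - [:0, 1:] * Q + Polynomial.smult (Im \<xi>) P"
    have AB: "complex_of_real (poly A t) + \<i> * complex_of_real (poly B t) = (\<xi> - complex_of_real t) * (g t - f t)" for t
    proof -
      have "(\<xi> - complex_of_real t) * (g t - f t) = (\<xi> - complex_of_real t) * g t - 1"
        using nz[of t] by (simp add: f_def right_diff_distrib)
      also have "\<dots> = complex_of_real (poly A t) + \<i> * complex_of_real (poly B t)"
        by (simp add: A_def B_def g_def complex_eq_iff algebra_simps)
      finally show ?thesis by simp
    qed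
    have bound: "cmod (complex_of_real (poly A t) + \<i> * complex_of_real (poly B t)) \<le> K * e" if "\<bar>t\<bar> \<le> radius" for t
    proof -
      have "cmod (\<xi> - complex_of_real t) \<le> cmod \<xi> + radius"
        using norm_triangle_ineq4[of \<xi> "complex_of_real t"] that by simp
      then have "cmod (\<xi> - complex_of_real t) * cmod (g t - f t) \<le> (cmod \<xi> + radius) * (2 * e)"
        using fg[OF that] radius(1) by (intro mult_mono) (auto simp: norm_minus_commute intro: add_nonneg_nonneg)
      then show ?thesis unfolding AB norm_mult K_def by (simp add: algebra_simps)
    qed
    have nA: "norm (poly_orbit s d A) \<le> K * e"
    proof (rule norm_poly_orbit_le[OF s L])
      show "\<bar>poly A t\<bar> \<le> K * e" if "\<bar>t\<bar> \<le> radius" for t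
        using abs_Re_le_cmod[of "complex_of_real (poly A t) + \<i> * complex_of_real (poly B t)"] bound[OF that]
        by simp
    qed (use K e in simp)
    have nB: "norm (poly_orbit s d B) \<le> K * e"
    proof (rule norm_poly_orbit_le[OF s L])
      show "\<bar>poly B t\<bar> \<le> K * e" if "\<bar>t\<bar> \<le> radius" for t
        using abs_Im_le_cmod[of "complex_of_real (poly A t) + \<i> * complex_of_real (poly B t)"] bound[OF that]
        by simp
    qed (use K e in simp)
    define y where "y = poly_orbit s d P + scaleC \<i> (poly_orbit s d Q)"
    \<comment> \<open>The same identity with s in place of t and applied to d: the residual of the
      approximate solution y.\<close>
    have z: "(scaleC_op \<xi> - s) y - d = poly_orbit s d A + scaleC \<i> (poly_orbit s d B)"
    proof -
      have sA: "poly_orbit s d A = Re \<xi> *\<^sub>R poly_orbit s d P - s (poly_orbit s d P) - Im \<xi> *\<^sub>R poly_orbit s d Q - d"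
        unfolding A_def by (simp only: poly_orbit_diff poly_orbit_smult poly_orbit_mult_x poly_orbit_1)
      have sB: "poly_orbit s d B = Re \<xi> *\<^sub>R poly_orbit s d Q - s (poly_orbit s d Q) + Im \<xi> *\<^sub>R poly_orbit s d P"
        unfolding B_def by (simp only: poly_orbit_diff poly_orbit_add poly_orbit_smult poly_orbit_mult_x)
      show ?thesis
      proof (rule ell2_eqI)
        fix n
        show "coord ((scaleC_op \<xi> - s) y - d) n = coord (poly_orbit s d A + scaleC \<i> (poly_orbit s d B)) n"
          unfolding sA sB y_def
          by (simp add: blinfun.diff_left blinfun.add_right blinfun_scaleC[OF s(1)])
            (simp add: complex_eq_iff algebra_simps)
      qed
    qed
    have "norm ((scaleC_op \<xi> - s) y - d) \<le> 2 * K * e"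
      unfolding z using norm_triangle_ineq[of "poly_orbit s d A" "scaleC \<i> (poly_orbit s d B)"] nA nB
      by (simp add: norm_scaleC)
    then have "norm r * norm ((scaleC_op \<xi> - s) y - d) \<le> norm r * (2 * K * e)" by (intro mult_left_mono) auto
    moreover have "r ((scaleC_op \<xi> - s) y) = y" using arg_cong[OF r, of "\<lambda>h. blinfun_apply h y"] by simp
    then have "norm (y - r d) \<le> norm r * norm ((scaleC_op \<xi> - s) y - d)"
      using norm_blinfun[of r "(scaleC_op \<xi> - s) y - d"] by (simp only: blinfun.diff_right)
    ultimately have "norm d * norm (y - r d) \<le> norm d * (norm r * (2 * K * e))" by (intro mult_left_mono) auto
    then have 1: "cmod (cinner d y - cinner d (r d)) \<le> norm d * (norm r * (2 * K * e))"
      using norm_cinner_le[of d "y - r d"] by (simp add: cinner_diff_right)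
    have intg: "integrable \<mu> g" unfolding g_def
      by (intro Bochner_Integration.integrable_add integrable_mult_right integrable_of_real integrable_poly)
    have intf: "integrable \<mu> f"
    proof (rule integrable_bounded_on_support)
      show "f \<in> borel_measurable borel" using contf by (intro borel_measurable_continuous_onI)
      show "norm (f t) \<le> 1 / Im \<xi>" for t
        using abs_Im_le_cmod[of "\<xi> - complex_of_real t"] \<xi>
        by (simp add: f_def norm_divide frac_le)
    qed
    have "cinner d y = complex_of_real (\<integral>t. poly P t \<partial>\<mu>) + \<i> * complex_of_real (\<integral>t. poly Q t \<partial>\<mu>)"
      by (simp add: y_def cinner_add_right cinner_scaleC_right L)
    also have "\<dots> = (\<integral>t. g t \<partial>\<mu>)"
      unfolding g_def by (subst Bochner_Integration.integral_add) simp_all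
    finally have "cauchy_transform \<mu> \<xi> - cinner d y = (\<integral>t. f t - g t \<partial>\<mu>)"
      using intf intg by (simp add: cauchy_transform_def f_def[abs_def])
    also have "cmod \<dots> \<le> (\<integral>t. cmod (f t - g t) \<partial>\<mu>)" by (rule integral_norm_bound)
    also have "\<dots> \<le> (\<integral>t. 2 * e \<partial>\<mu>)"
      using intf intg AE_radius by (intro integral_mono_AE) (auto intro: fg AE_mp)
    also have "\<dots> = 2 * e" using prob_space by simp
    finally have 2: "cmod (cauchy_transform \<mu> \<xi> - cinner d y) \<le> 2 * e" .
    show ?thesis
      using norm_triangle_ineq[of "cauchy_transform \<mu> \<xi> - cinner d y" "cinner d y - cinner d (r d)"] 1 2
      by (simp add: algebra_simps)
  qed
  define c where "c = 2 + norm d * (norm r * (2 * K))"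
  have "c > 0" using K by (auto simp: c_def intro!: add_pos_nonneg mult_nonneg_nonneg)
  have "cmod (cauchy_transform \<mu> \<xi> - cinner d (r d)) \<le> 0"
  proof (rule field_le_epsilon)
    fix e :: real assume "e > 0"
    then show "cmod (cauchy_transform \<mu> \<xi> - cinner d (r d)) \<le> 0 + e"
      using main[of "e / c"] \<open>c > 0\<close> by (simp add: c_def[symmetric])
  qed
  then show ?thesis by simp
qed

end

text \<open>With T^j S e_k read as the tensor product of e_k and e_j, this is the tensor square of
  e_m.\<close>

definition diag_vec :: "nat \<Rightarrow> ell2" where
  "diag_vec m = (blinfun_apply odd_embed ^^ m) (even_embed (basis_vec m))"

lemma ampl_diag: "ampl b ((blinfun_apply odd_embed ^^ m) (even_embed v)) = (blinfun_apply odd_embed ^^ m) (even_embed (b v))"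
  by (induction m) simp_all

lemma cinner_diag_vec: "cinner (diag_vec 0) (diag_vec m) = of_bool (m = 0)"
proof -
  have "cinner (diag_vec 0) w = cinner (basis_vec 0) (even_part w)" for w
    unfolding diag_vec_def by (simp add: cinner_adjoint_left)
  then show ?thesis by (cases m) (simp_all add: diag_vec_def cinner_basis_vec)
qed

context jacobi
begin

context
  fixes D V :: "ell2 \<Rightarrow>\<^sub>L ell2"
  assumes D: "D \<in> carrier B_ell2" "adjoint_op D = D" "\<And>x n. coord (D x) n = complex_of_real (\<alpha> (Suc n)) * coord x n"
    and V: "V \<in> carrier B_ell2" "\<And>x n. coord (V x) n = complex_of_real (sqrt (\<omega> (Suc n))) * coord x (Suc n)"
begin

lemma V_adjoint_basis_vec: "adjoint_op V (basis_vec m) = sqrt (\<omega> (Suc m)) *\<^sub>R basis_vec (Suc m)"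
proof (rule ell2_eqI)
  fix n
  have "coord (adjoint_op V (basis_vec m)) n = cnj (coord (V (basis_vec n)) m)"
    by (simp only: cinner_basis_vec[symmetric] cinner_adjoint_right[OF V(1)] cinner_commute[of "V _"] complex_cnj_cnj)
  then show "coord (adjoint_op V (basis_vec m)) n = coord (sqrt (\<omega> (Suc m)) *\<^sub>R basis_vec (Suc m)) n"
    by (auto simp: V(2))
qed

text \<open>V and the backward shift lower both tensor indices together, and the adjoint term raises
  both, so the diagonal is preserved.\<close>

lemma semicirc_diag_vec:
  "semicirc D V (diag_vec m) = \<alpha> (Suc m) *\<^sub>R diag_vec m + sqrt (\<omega> (Suc m)) *\<^sub>R diag_vec (Suc m)
     + (if m = 0 then 0 else sqrt (\<omega> m) *\<^sub>R diag_vec (m - 1))"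
proof -
  have scale: "(blinfun_apply odd_embed ^^ k) (c *\<^sub>R v) = c *\<^sub>R (blinfun_apply odd_embed ^^ k) v" for k c v
    by (induction k) (simp_all add: blinfun.scaleR_right)
  have "D (basis_vec m) = \<alpha> (Suc m) *\<^sub>R basis_vec m"
    by (rule ell2_eqI) (auto simp: D(3))
  then have 1: "ampl D (diag_vec m) = \<alpha> (Suc m) *\<^sub>R diag_vec m"
    by (simp add: diag_vec_def ampl_diag blinfun.scaleR_right scale)
  have 2: "odd_embed (ampl (adjoint_op V) (diag_vec m)) = sqrt (\<omega> (Suc m)) *\<^sub>R diag_vec (Suc m)"
    by (simp add: diag_vec_def ampl_diag V_adjoint_basis_vec blinfun.scaleR_right scale)
  have 3: "ampl V (odd_part (diag_vec m)) = (if m = 0 then 0 else sqrt (\<omega> m) *\<^sub>R diag_vec (m - 1))"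
  proof (cases m)
    case 0
    then show ?thesis by (simp add: diag_vec_def blinfun.zero_right)
  next
    case (Suc k)
    have "V (basis_vec m) = sqrt (\<omega> m) *\<^sub>R basis_vec k"
      by (rule ell2_eqI) (auto simp: V(2) Suc)
    then show ?thesis
      using Suc by (simp add: diag_vec_def ampl_diag blinfun.scaleR_right scale)
  qed
  show ?thesis
    unfolding semicirc_def by (simp add: blinfun.add_left 1 2 3)
qed

text \<open>The product is the L^2 norm of p_m, which relates monic polynomials to the symmetric
  Jacobi matrix. The recurrence is used only up to index m - 1, so m may equal the number of support
  points, where the product is 0.\<close>

lemma poly_orbit_monic_OP:
  "(m = 0 \<or> proper_index (m - 1)) \<Longrightarrow>
    poly_orbit (semicirc D V) (diag_vec 0) (monic_OP \<mu> m) = (\<Prod>i=1..m. sqrt (\<omega> i)) *\<^sub>R diag_vec m"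
proof (induction m rule: less_induct)
  case (less m)
  let ?s = "semicirc D V" and ?c = "\<lambda>m. \<Prod>i=1..m. sqrt (\<omega> i)" and ?d = diag_vec
  let ?P = "poly_orbit ?s (?d 0)"
  show ?case
  proof (cases m)
    case 0
    then show ?thesis by (simp add: monic_OP_0)
  next
    case (Suc k)
    then have k: "proper_index k" using less.prems by simp
    have c: "?c (Suc k) = ?c k * sqrt (\<omega> (Suc k))" by simp
    have Pk: "?P (monic_OP \<mu> k) = ?c k *\<^sub>R ?d k"
      using Suc proper_index_mono[OF k, of "k - 1"] by (intro less.IH) auto
    have "?P (monic_OP \<mu> m) = ?s (?P (monic_OP \<mu> k)) - \<alpha> (Suc k) *\<^sub>R ?P (monic_OP \<mu> k)
        - (if k = 0 then 0 else \<omega> k *\<^sub>R ?P (monic_OP \<mu> (k - 1)))"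
      using arg_cong[OF monic_OP_recurrence[OF k], of ?P] Suc
      unfolding poly_orbit_mult_x by (simp add: poly_orbit_add poly_orbit_smult del: mult_pCons_left)
    also have "(if k = 0 then 0 else \<omega> k *\<^sub>R ?P (monic_OP \<mu> (k - 1)))
        = ?c k *\<^sub>R (if k = 0 then 0 else sqrt (\<omega> k) *\<^sub>R ?d (k - 1))"
    proof (cases k)
      case (Suc l)
      then have Pl: "?P (monic_OP \<mu> l) = ?c l *\<^sub>R ?d l"
        using \<open>m = Suc k\<close> proper_index_mono[OF k, of "l - 1"] by (intro less.IH) auto
      have "sqrt (\<omega> (Suc l)) * sqrt (\<omega> (Suc l)) = \<omega> (Suc l)"
        using omega_nonneg[of "Suc l"] by simp
      \<comment> \<open>With this the lower term of the recurrence cancels the lower off-diagonal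
        term of the Jacobi matrix exactly.\<close>
      then have "?c (Suc l) * sqrt (\<omega> (Suc l)) = \<omega> (Suc l) * ?c l"
        by (simp add: mult.assoc mult.commute del: real_sqrt_mult_self)
      then show ?thesis
        unfolding Suc by (simp only: nat.distinct if_False diff_Suc_1 Pl scaleR_scaleR)
    qed simp
    also have "?s (?P (monic_OP \<mu> k)) = ?c k *\<^sub>R (\<alpha> (Suc k) *\<^sub>R ?d k + sqrt (\<omega> (Suc k)) *\<^sub>R ?d (Suc k)
        + (if k = 0 then 0 else sqrt (\<omega> k) *\<^sub>R ?d (k - 1)))"
      unfolding Pk by (simp only: blinfun.scaleR_right semicirc_diag_vec)
    finally have "?P (monic_OP \<mu> m) = ?c (Suc k) *\<^sub>R ?d (Suc k)"
      unfolding Pk c by (simp add: scaleR_add_right mult.commute)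
    with Suc show ?thesis by simp
  qed
qed

lemma cinner_poly_orbit_eq_integral:
  "cinner (diag_vec 0) (poly_orbit (semicirc D V) (diag_vec 0) q) = complex_of_real (\<integral>t. poly q t \<partial>\<mu>)"
proof (rule integral_poly_unique)
  fix m assume "proper_index (Suc m)"
  then have "proper_index m" by (rule proper_index_mono) simp
  then show "cinner (diag_vec 0) (poly_orbit (semicirc D V) (diag_vec 0) (monic_OP \<mu> (Suc m))) = 0"
    by (subst poly_orbit_monic_OP) (simp_all add: cinner_scaleR_right cinner_diag_vec)
next
  fix k assume fin: "finite (msupport \<mu>)"
  let ?m = "card (msupport \<mu>)"
  \<comment> \<open>Positivity matters: an empty product would be 1, whereas the factor at
    \<open>?m\<close> is 0 by the extension of \<omega> by zero.\<close>
  have m: "?m > 0" using fin msupport_nonempty by (simp add: card_gt_0_iff)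
  have "poly_orbit (semicirc D V) (diag_vec 0) (monic_OP \<mu> ?m) = (\<Prod>i=1..?m. sqrt (\<omega> i)) *\<^sub>R diag_vec ?m"
    using m by (intro poly_orbit_monic_OP) (simp add: proper_index_def)
  also have "(\<Prod>i=1..?m. sqrt (\<omega> i)) = 0"
    using m improper_zero(1)[of ?m] fin by (intro prod_zero bexI[of _ ?m]) (auto simp: proper_index_def)
  finally have "poly_orbit (semicirc D V) (diag_vec 0) (monic_OP \<mu> ?m) = 0" by simp
  then show "cinner (diag_vec 0) (poly_orbit (semicirc D V) (diag_vec 0) (monic_OP \<mu> ?m * monom 1 k)) = 0"
    by (simp add: poly_orbit_mult_eq_0)
qed (simp_all add: poly_orbit_add poly_orbit_smult cinner_add_right cinner_scaleR_right cinner_diag_vec)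

lemma cauchy_transform_semicirc:
  assumes \<xi>: "Im \<xi> > 0"
  shows "cauchy_transform \<mu> \<xi> =
    cinner (basis_vec 0) (opvalued_cauchy B_ell2 ampl corner (semicirc D V) (scaleC_op \<xi>) (basis_vec 0))"
proof -
  have "Im \<xi> * (norm v)\<^sup>2 \<le> Im (cinner v (ampl (scaleC_op \<xi>) v))" for v
    by (simp add: ampl_scaleC_op cinner_scaleC_right cinner_self)
  from semicirc_resolvent[OF D(1) V(1) D(2) _ \<xi> this] obtain r where
    r: "r o\<^sub>L (scaleC_op \<xi> - semicirc D V) = id_blinfun"
    "opvalued_cauchy B_ell2 ampl corner (semicirc D V) (scaleC_op \<xi>) = corner r"
    by (auto simp: ampl_scaleC_op)
  have "cauchy_transform \<mu> \<xi> = cinner (diag_vec 0) (r (diag_vec 0))"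
    using semicirc_carrier[OF D(1) V(1) D(2)] semicirc_selfadjoint[OF D(1) V(1) D(2)]
      cinner_poly_orbit_eq_integral r(1) \<xi> by (rule cauchy_transform_eq_resolvent)
  also have "\<dots> = cinner (basis_vec 0) (corner r (basis_vec 0))"
    by (simp add: diag_vec_def cinner_adjoint_left)
  finally show ?thesis by (simp only: r(2))
qed

end

end

lemma vector_state: "norm v = 1 \<Longrightarrow> cstar_state B_ell2 (\<lambda>a. cinner v (a v))"
  unfolding cstar_state_def
  by (auto simp: blinfun.add_left cinner_add_right cinner_scaleC_right cinner_adjoint_right cinner_self)

theorem theorem3p1:
  fixes \<mu> :: "real measure" and \<omega> \<alpha> :: "nat \<Rightarrow> real"
  assumes "real_distribution \<mu>"
    and "compactly_supported \<mu>"
    and "jacobi_coefficients \<mu> \<omega> \<alpha>"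
  shows "\<exists>D\<in>carrier B_ell2. \<exists>V\<in>carrier B_ell2. \<exists>W\<in>carrier B_ell2.
    (\<forall>k l. op_matrix D k l = complex_of_real (\<alpha> (k + 1)) * of_bool (k = l)) \<and>
    (\<forall>k l. op_matrix V k l = complex_of_real (sqrt (\<omega> (k + 1))) * of_bool (k + 1 = l)) \<and>
    (\<forall>k l. op_matrix W k l = complex_of_real (sqrt (\<omega> k)) * of_bool (k = l + 1)) \<and>
    (\<exists>(A :: (ell2 \<Rightarrow>\<^sub>L ell2) cstar) \<iota> E s \<rho>.
       opvalued_space A B_ell2 \<iota> E \<and>
       semicircular A B_ell2 \<iota> E s D (\<lambda>a. V \<otimes>\<^bsub>B_ell2\<^esub> a \<otimes>\<^bsub>B_ell2\<^esub> W) \<and>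
       cstar_state B_ell2 \<rho> \<and>
       (\<forall>\<xi>. Im \<xi> > 0 \<longrightarrow>
          cauchy_transform \<mu> \<xi> = \<rho> (opvalued_cauchy A \<iota> E s (\<xi> \<odot>\<^bsub>B_ell2\<^esub> \<one>\<^bsub>B_ell2\<^esub>))))"
proof -
  interpret J: jacobi \<mu> \<omega> \<alpha>
    using assms by (simp add: jacobi_def compact_real_distribution_def
        compact_real_distribution_axioms_def jacobi_axioms_def)
  obtain D where D: "D \<in> carrier B_ell2" "\<And>x n. coord (D x) n = complex_of_real (\<alpha> (Suc n)) * coord x n"
    using diagonal_operator_exists[of "\<lambda>n. \<alpha> (Suc n)" J.radius] J.abs_alpha_le by blast
  have "\<bar>sqrt (\<omega> (Suc n))\<bar> \<le> J.radius" for n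
    using real_sqrt_le_mono[OF J.omega_le[of n]] J.omega_nonneg[of "Suc n"] J.radius(1) by simp
  then obtain S where S: "S \<in> carrier B_ell2" "\<And>x n. coord (S x) n = complex_of_real (sqrt (\<omega> (Suc n))) * coord x n"
    using diagonal_operator_exists[of "\<lambda>n. sqrt (\<omega> (Suc n))" J.radius] by blast
  \<comment> \<open>The backward shift followed by the weights puts them on the superdiagonal: V
    sends e_{n+1} to sqrt(\<omega> (n+1)) e_n, indices counted from 0.\<close>
  define V where "V = S o\<^sub>L pull Suc"
  have V: "V \<in> carrier B_ell2" "\<And>x n. coord (V x) n = complex_of_real (sqrt (\<omega> (Suc n))) * coord x (Suc n)"
    using S pull_carrier[of Suc] by (simp_all add: V_def carrier_closed coord_pull)
  have D': "adjoint_op D = D"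
  proof (rule adjoint_op_unique)
    fix x y show "cinner (D x) y = cinner x (D y)"
      unfolding cinner_def by (simp add: D(2) mult_ac)
  qed
  note DV = D(1) D' D(2) V
  have semi: "semicircular B_ell2 B_ell2 ampl corner (semicirc D V) D
      (\<lambda>a. V \<otimes>\<^bsub>B_ell2\<^esub> a \<otimes>\<^bsub>B_ell2\<^esub> adjoint_op V)"
    using D(1) V(1) D' by (rule semicircular_semicirc)
  have "cstar_state B_ell2 (\<lambda>a. cinner (basis_vec 0) (a (basis_vec 0)))"
    by (rule vector_state) simp
  moreover have "cauchy_transform \<mu> \<xi> = cinner (basis_vec 0)
      (opvalued_cauchy B_ell2 ampl corner (semicirc D V) (\<xi> \<odot>\<^bsub>B_ell2\<^esub> \<one>\<^bsub>B_ell2\<^esub>) (basis_vec 0))" if "Im \<xi> > 0" for \<xi>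
  proof -
    have "\<xi> \<odot>\<^bsub>B_ell2\<^esub> \<one>\<^bsub>B_ell2\<^esub> = scaleC_op \<xi>" by (auto intro!: blinfun_eqI)
    with J.cauchy_transform_semicirc[OF DV that] show ?thesis by (simp only:)
  qed
  ultimately have ex: "\<exists>(A :: (ell2 \<Rightarrow>\<^sub>L ell2) cstar) \<iota> E s \<rho>.
       opvalued_space A B_ell2 \<iota> E \<and>
       semicircular A B_ell2 \<iota> E s D (\<lambda>a. V \<otimes>\<^bsub>B_ell2\<^esub> a \<otimes>\<^bsub>B_ell2\<^esub> adjoint_op V) \<and>
       cstar_state B_ell2 \<rho> \<and>
       (\<forall>\<xi>. Im \<xi> > 0 \<longrightarrow>
          cauchy_transform \<mu> \<xi> = \<rho> (opvalued_cauchy A \<iota> E s (\<xi> \<odot>\<^bsub>B_ell2\<^esub> \<one>\<^bsub>B_ell2\<^esub>)))"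
    using opvalued_space_ampl semi by blast
  \<comment> \<open>The third matrix is realized as V*. In row 0 the Kronecker factor is 0 for every
    l, so the undetermined \<open>\<omega> 0\<close> is multiplied by 0.\<close>
  have W: "op_matrix (adjoint_op V) k l = complex_of_real (sqrt (\<omega> k)) * of_bool (k = l + 1)" for k l
    by (auto simp: op_matrix_def J.V_adjoint_basis_vec[OF DV])
  show ?thesis
    by (rule bexI[OF _ D(1)], rule bexI[OF _ V(1)], rule bexI[OF _ adjoint_op_closed[OF V(1)]], intro conjI)
      (use ex W in \<open>auto simp: op_matrix_def D(2) V(2)\<close>)
qed

end
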